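(* Let $n,q$ be positive integers and let $c\in\mathbb{R}\setminus\{0\}$ be fixed. Assume that the tropical holomorphic map $f=[f_0:\dots:f_n]:\mathbb{R}\to\mathbb{TP}^n$ (with reduced representation $(f_0,\dots,f_n)$) is tropically linearly nondegenerate. Let $H_1,\dots,H_q$ be tropical hyperplanes in $\mathbb{TP}^n$ in general position, defined by tropical linear polynomials $P_1,\dots,P_q$ respectively. If $$\limsup_{r\to\infty}\frac{\log T_f(r)}{r}=0,$$ then $$(q-n-1)\,T_f(r)\le \sum_{j=1}^q N\bigl(r,1_{\mathbb{T}}\oslash (P_j\circ f)\bigr)-N\bigl(r,1_{\mathbb{T}}\oslash C(f)\bigr)+o(T_f(r)),$$ where $r$ tends to infinity outside of a set of zero upper density measure, and $C(f)$ is the tropical Casorati determinant of $f$ (with shift $c$).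
   Context: Tropical semiring: $\mathbb{T}=\mathbb{R}\cup\{-\infty\}$, $x\oplus y=\max(x,y)$, $x\otimes y=x+y$, $x\oslash y=x-y$, $0_{\mathbb{T}}=-\infty$, $1_{\mathbb{T}}=0$. Tropical projective space $\mathbb{TP}^n$ is $\mathbb{T}^{n+1}\setminus\{(0_{\mathbb{T}},\dots,0_{\mathbb{T}})\}$ modulo $(a_0,\dots,a_n)\sim(\lambda+a_0,\dots,\lambda+a_n)$, $\lambda\in\mathbb{R}$. Hyperplanes: a tropical linear polynomial is $P(x)=\max_{0\le i\le n}(a_i+x_i)$ with coefficient vector $a=(a_0,\dots,a_n)\in\mathbb{T}^{n+1}$ not all $0_{\mathbb{T}}$. The tropical hyperplane it defines is $H=\{x\in\mathbb{TP}^n:\ \max_i(a_i+x_i)\text{ is attained at least twice}\}$ (in particular $x\in H$ if all terms are $-\infty$). $H_1,\dots,H_q$ are in general position if $H_{\mu(0)}\cap\dots\cap H_{\mu(n)}=\varnothing$ for every injective map $\mu:\{0,\dots,n\}\to\{1,\dots,q\}$. Functions: a tropical meromorphic function is a continuous piecewise linear $g:\mathbb{R}\to\mathbb{R}$. Put $\omega_g(x)=\lim_{\varepsilon\to0^+}(g'(x+\varepsilon)-g'(x-\varepsilon))$; $x$ is a root of multiplicity $\omega_g(x)$ if $\omega_g(x)>0$, and a pole of multiplicity $-\omega_g(x)$ if $\omega_g(x)<0$. A tropical entire function is a tropical meromorphic function without poles. The counting function is $N(r,g)=\frac12\int_0^r n(t,g)\,dt$ with $n(t,g)=\sum_{|s|\le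 t,\ \omega_g(s)<0}|\omega_g(s)|$ (poles); thus $N(r,1_{\mathbb{T}}\oslash g)=N(r,-g)$ counts the roots of $g$. Curves: a tropical holomorphic map (curve) $f=[f_0:\dots:f_n]:\mathbb{R}\to\mathbb{TP}^n$ is given by tropical entire functions $f_0,\dots,f_n$ without any common roots (reduced representation). Put $\|f(x)\|=\max_i f_i(x)$, $T_f(r)=\frac12(\|f(r)\|+\|f(-r)\|)-\|f(0)\|$, and $P\circ f=\max_i(a_i+f_i)$. The map $f$ is tropically linearly nondegenerate if $f(\mathbb{R})$ is not contained in any tropical hyperplane of $\mathbb{TP}^n$. Casorati determinant: $C(f)(x)=\max_{\pi}\sum_{i=0}^n f_i(x+\pi(i)c)$, the maximum over all permutations $\pi$ of $\{0,\dots,n\}$. A set $E$ has zero upper density measure if $\limsup_{r\to\infty}\frac1r\int_{E\cap[1,r]}dt=0$.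
   Formalization: For q ≤ n the general position condition is void and the claim can fail (n=q=2, P_1=P_2=x_0, f=[0:|x|:2|x|], c=1), so in that case it is additionally assumed that H_1,…,H_q can be completed to n+1 tropical hyperplanes in general position. *)

theory Defs
  imports "HOL-Analysis.Analysis" "HOL-Combinatorics.Permutations" "HOL-Library.Landau_Symbols"
begin

text \<open>The tropical semiring is the extended real line without \<^term>\<open>\<infinity> :: ereal\<close>; its zero
  is \<^term>\<open>- \<infinity> :: ereal\<close>. A vector with entries \<open>0, \<dots>, n\<close> is a function on \<open>nat\<close> that is
  \<^term>\<open>undefined\<close> beyond \<open>n\<close>.\<close>

definition tropicals :: "ereal set" where
  "tropicals = {x. x \<noteq> \<infinity>}"

definition trop_nonzero_vecs :: "nat \<Rightarrow> (nat \<Rightarrow> ereal) set" where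
  "trop_nonzero_vecs n = {x \<in> {0..n} \<rightarrow>\<^sub>E tropicals. \<exists>i\<in>{0..n}. x i \<noteq> - \<infinity>}"

definition trop_proj_rel :: "nat \<Rightarrow> ((nat \<Rightarrow> ereal) \<times> (nat \<Rightarrow> ereal)) set" where
  "trop_proj_rel n = {(x, y). x \<in> trop_nonzero_vecs n \<and> y \<in> trop_nonzero_vecs n \<and>
     (\<exists>l::real. \<forall>i\<in>{0..n}. y i = ereal l + x i)}"

definition trop_proj_space :: "nat \<Rightarrow> (nat \<Rightarrow> ereal) set set" where
  "trop_proj_space n = trop_nonzero_vecs n // trop_proj_rel n"

definition trop_point :: "nat \<Rightarrow> (nat \<Rightarrow> ereal) \<Rightarrow> (nat \<Rightarrow> ereal) set" where
  "trop_point n x = trop_proj_rel n `` {x}"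

definition trop_linear :: "nat \<Rightarrow> (nat \<Rightarrow> ereal) \<Rightarrow> (nat \<Rightarrow> ereal) \<Rightarrow> ereal" where
  "trop_linear n a x = Max ((\<lambda>i. a i + x i) ` {0..n})"

definition max_attained_twice :: "nat \<Rightarrow> (nat \<Rightarrow> ereal) \<Rightarrow> (nat \<Rightarrow> ereal) \<Rightarrow> bool" where
  "max_attained_twice n a x \<longleftrightarrow> (\<exists>i\<in>{0..n}. \<exists>j\<in>{0..n}. i \<noteq> j \<and>
     a i + x i = trop_linear n a x \<and> a j + x j = trop_linear n a x)"

text \<open>The condition below does not depend on the chosen representative \<open>x\<close> of \<open>p\<close>.\<close>

definition trop_hyperplane :: "nat \<Rightarrow> (nat \<Rightarrow> ereal) \<Rightarrow> (nat \<Rightarrow> ereal) set set" where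
  "trop_hyperplane n a = {p \<in> trop_proj_space n. \<exists>x\<in>p. max_attained_twice n a x}"

text \<open>For \<open>q \<le> n\<close> there is no injective \<open>\<mu>\<close> and this condition is void. A family of at most \<open>n\<close>
  hyperplanes is genuinely in general position if it can be completed to \<open>n + 1\<close> hyperplanes
  in general position; the predicate \<open>completable\<close> expresses this.\<close>

definition general_position :: "nat \<Rightarrow> nat \<Rightarrow> (nat \<Rightarrow> (nat \<Rightarrow> ereal) set set) \<Rightarrow> bool" where
  "general_position n q H \<longleftrightarrow>
     (\<forall>\<mu>. \<mu> \<in> {0..n} \<rightarrow> {1..q} \<and> inj_on \<mu> {0..n} \<longrightarrow> (\<Inter>i\<in>{0..n}. H (\<mu> i)) = {})"

definition completable :: "nat \<Rightarrow> nat \<Rightarrow> (nat \<Rightarrow> (nat \<Rightarrow> ereal) set set) \<Rightarrow> bool" where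
  "completable n q H \<longleftrightarrow>
     (\<exists>b. (\<forall>j\<in>{1..n + 1}. b j \<in> trop_nonzero_vecs n) \<and>
        (\<forall>j\<in>{1..q}. trop_hyperplane n (b j) = H j) \<and>
        general_position n (n + 1) (\<lambda>j. trop_hyperplane n (b j)))"

text \<open>Piecewise linear: affine between consecutive points of a locally finite set of breakpoints.\<close>

definition piecewise_linear :: "(real \<Rightarrow> real) \<Rightarrow> bool" where
  "piecewise_linear g \<longleftrightarrow> (\<exists>S. (\<forall>u v. finite (S \<inter> {u..v})) \<and>
     (\<forall>u v. {u<..<v} \<inter> S = {} \<longrightarrow> (\<exists>m b. \<forall>x\<in>{u<..<v}. g x = m * x + b)))"

definition trop_meromorphic :: "(real \<Rightarrow> real) \<Rightarrow> bool" where
  "trop_meromorphic g \<longleftrightarrow> continuous_on UNIV g \<and> piecewise_linear g"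

definition slope_jump :: "(real \<Rightarrow> real) \<Rightarrow> real \<Rightarrow> real" where
  "slope_jump g x = Lim (at_right 0) (\<lambda>e. deriv g (x + e) - deriv g (x - e))"

definition trop_root :: "(real \<Rightarrow> real) \<Rightarrow> real \<Rightarrow> bool" where
  "trop_root g x \<longleftrightarrow> slope_jump g x > 0"

definition trop_pole :: "(real \<Rightarrow> real) \<Rightarrow> real \<Rightarrow> bool" where
  "trop_pole g x \<longleftrightarrow> slope_jump g x < 0"

definition trop_entire :: "(real \<Rightarrow> real) \<Rightarrow> bool" where
  "trop_entire g \<longleftrightarrow> trop_meromorphic g \<and> (\<forall>x. \<not> trop_pole g x)"

definition pole_count :: "real \<Rightarrow> (real \<Rightarrow> real) \<Rightarrow> real" where
  "pole_count t g = (\<Sum>s | \<bar>s\<bar> \<le> t \<and> trop_pole g s. \<bar>slope_jump g s\<bar>)"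

definition counting_fun :: "real \<Rightarrow> (real \<Rightarrow> real) \<Rightarrow> real" where
  "counting_fun r g = 1 / 2 * integral {0..r} (\<lambda>t. pole_count t g)"

text \<open>The tropical reciprocal of \<open>g\<close>, whose poles are the roots of \<open>g\<close>.\<close>

definition trop_inverse :: "(real \<Rightarrow> real) \<Rightarrow> real \<Rightarrow> real" where
  "trop_inverse g x = 0 - g x"

definition reduced_representation :: "nat \<Rightarrow> (nat \<Rightarrow> real \<Rightarrow> real) \<Rightarrow> bool" where
  "reduced_representation n f \<longleftrightarrow> (\<forall>i\<in>{0..n}. trop_entire (f i)) \<and>
     \<not> (\<exists>x. \<forall>i\<in>{0..n}. trop_root (f i) x)"

definition trop_curve :: "nat \<Rightarrow> (nat \<Rightarrow> real \<Rightarrow> real) \<Rightarrow> real \<Rightarrow> (nat \<Rightarrow> ereal) set" where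
  "trop_curve n f x = trop_point n (\<lambda>i\<in>{0..n}. ereal (f i x))"

definition trop_linearly_nondegenerate :: "nat \<Rightarrow> (nat \<Rightarrow> real \<Rightarrow> real) \<Rightarrow> bool" where
  "trop_linearly_nondegenerate n f \<longleftrightarrow>
     \<not> (\<exists>a\<in>trop_nonzero_vecs n. range (trop_curve n f) \<subseteq> trop_hyperplane n a)"

definition curve_norm :: "nat \<Rightarrow> (nat \<Rightarrow> real \<Rightarrow> real) \<Rightarrow> real \<Rightarrow> real" where
  "curve_norm n f x = Max ((\<lambda>i. f i x) ` {0..n})"

definition characteristic_fun :: "nat \<Rightarrow> (nat \<Rightarrow> real \<Rightarrow> real) \<Rightarrow> real \<Rightarrow> real" where
  "characteristic_fun n f r =
     1 / 2 * (curve_norm n f r + curve_norm n f (- r)) - curve_norm n f 0"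

text \<open>The maximum is finite for a coefficient vector that is not tropically zero, so
  \<^const>\<open>real_of_ereal\<close> only changes its type.\<close>

definition trop_linear_comp :: "nat \<Rightarrow> (nat \<Rightarrow> ereal) \<Rightarrow> (nat \<Rightarrow> real \<Rightarrow> real) \<Rightarrow> real \<Rightarrow> real" where
  "trop_linear_comp n a f x = real_of_ereal (trop_linear n a (\<lambda>i. ereal (f i x)))"

definition casorati :: "nat \<Rightarrow> real \<Rightarrow> (nat \<Rightarrow> real \<Rightarrow> real) \<Rightarrow> real \<Rightarrow> real" where
  "casorati n c f x = Max ((\<lambda>p. \<Sum>i=0..n. f i (x + real (p i) * c)) ` {p. p permutes {0..n}})"

definition zero_upper_density :: "real set \<Rightarrow> bool" where
  "zero_upper_density E \<longleftrightarrow> E \<in> sets lebesgue \<and>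
     Limsup at_top (\<lambda>r. ereal (1 / r * (LINT t:E \<inter> {1..r}|lebesgue. 1))) = 0"

text \<open>The filter of \<open>r\<close> tending to infinity outside of \<open>E\<close>.\<close>

definition at_top_outside :: "real set \<Rightarrow> real filter" where
  "at_top_outside E = inf at_top (principal (- E))"

end

theory Submission
  imports Defs
begin

text \<open>
  This is the tropical analogue of Cartan's second main theorem in which the Casorati
  determinant takes the place of the Wronskian. Write \<open>g j\<close> for the composition of the \<open>j\<close>-th linear form with the curve,
  \<open>F\<close> for the norm of the curve and \<open>C\<close> for the Casorati determinant.

  All these functions are maxima of sums of shifted tropical entire functions, hence convex and
  piecewise linear, and for such a function the tropical Jensen formula \<open>trop_Jensen\<close> reads
  \<open>N(r, - g) = (g r + g (- r)) / 2 - g 0\<close>. The theorem is thereby reduced to an inequality between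
  function values at \<open>r\<close> and at \<open>- r\<close>, namely
  \<open>C + (q - n - 1) * F \<le> (\<Sum>j. g j) + o(T)\<close>.

  This inequality is \<open>casorati_pointwise_estimate\<close>. Its algebraic input is
  \<open>general_position_matching\<close>: for \<open>n + 1\<close> hyperplanes in general position, the rows of the
  coefficient matrix can be matched to its columns through finite entries. Indeed, if the tropical
  determinant is \<open>- \<infinity>\<close>, a tropical Cramer rule produces a common point of the hyperplanes.
  Expanding \<open>C\<close> along the matching for the \<open>n + 1\<close> smallest forms bounds \<open>C\<close> by their sum at points
  shifted by multiples of \<open>c\<close>, and the same matching shows that each remaining form is as large as
  \<open>F\<close> up to a constant. Fewer than \<open>n + 1\<close> hyperplanes are first completed to \<open>n + 1\<close>.

  It remains to remove the shifts. By convexity the increase of any \<open>g j\<close> under a bounded shift is,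
  up to a constant, at most that of the function \<open>U r = 1 + (\<Sum>j. g j r + g j (- r) - 2 * g j 0)\<close>
  (\<open>convex_shift_le\<close>). Since \<open>U\<close> is \<open>O(T)\<close>, the growth condition gives \<open>ln (U r) = o(r)\<close>, and then
  \<open>U (r + s) - U r = o(U r)\<close> off a set of zero upper density (\<open>slow_growth_shift\<close>). The constants are
  \<open>o(T)\<close> because nondegeneracy makes \<open>T\<close> unbounded (\<open>characteristic_fun_at_top\<close>).
\<close>

section \<open>Local structure of piecewise linear functions\<close>

text \<open>The slopes \<open>l\<close> and \<open>m\<close> are the one-sided derivatives of \<open>g\<close> at \<open>x\<close>. Piecewise linearity is
handled through this pointwise condition rather than through a global set of breakpoints: it is
visibly stable under sums, shifts and maxima, where a maximum creates new breakpoints at the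
crossings of the two graphs.\<close>

definition kink :: "(real \<Rightarrow> real) \<Rightarrow> real \<Rightarrow> real \<Rightarrow> real \<Rightarrow> bool" where
  "kink g x l m \<longleftrightarrow>
     (\<forall>\<^sub>F y in nhds x. g y = g x + (if y < x then l else m) * (y - x))"

definition locally_pl :: "(real \<Rightarrow> real) \<Rightarrow> bool" where
  "locally_pl g \<longleftrightarrow> (\<forall>x. \<exists>l m. kink g x l m)"

lemma kinkI:
  assumes "e > 0" "\<And>y. x - e < y \<Longrightarrow> y < x \<Longrightarrow> g y = g x + l * (y - x)"
    "\<And>y. x < y \<Longrightarrow> y < x + e \<Longrightarrow> g y = g x + m * (y - x)"
  shows "kink g x l m"
proof -
  have "g y = g x + (if y < x then l else m) * (y - x)" if "dist y x < e" for y
    using assms that by (cases y x rule: linorder_cases) (auto simp: dist_real_def)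
  then show ?thesis
    unfolding kink_def eventually_nhds_metric using \<open>e > 0\<close> by blast
qed

lemma kinkD:
  assumes "kink g x l m"
  shows "\<exists>e>0. (\<forall>y. x - e < y \<longrightarrow> y \<le> x \<longrightarrow> g y = g x + l * (y - x)) \<and>
    (\<forall>y. x \<le> y \<longrightarrow> y < x + e \<longrightarrow> g y = g x + m * (y - x))"
proof -
  obtain e where "e > 0"
    and e: "\<And>y. dist y x < e \<Longrightarrow> g y = g x + (if y < x then l else m) * (y - x)"
    using assms unfolding kink_def eventually_nhds_metric by blast
  have "g y = g x + l * (y - x)" if "x - e < y" "y \<le> x" for y
    using e[of y] that by (cases "y = x") (auto simp: dist_real_def)
  moreover have "g y = g x + m * (y - x)" if "x \<le> y" "y < x + e" for y
    using e[of y] that by (auto simp: dist_real_def)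
  ultimately show ?thesis
    using \<open>e > 0\<close> by blast
qed

lemma kink_near:
  assumes "kink g x l m"
  shows "\<forall>\<^sub>F y in at x. kink g y (if y < x then l else m) (if y < x then l else m)"
proof -
  obtain e where e: "e > 0" "\<And>y. x - e < y \<Longrightarrow> y \<le> x \<Longrightarrow> g y = g x + l * (y - x)"
    "\<And>y. x \<le> y \<Longrightarrow> y < x + e \<Longrightarrow> g y = g x + m * (y - x)"
    using kinkD[OF assms] by blast
  have "kink g y (if y < x then l else m) (if y < x then l else m)"
    if y: "y \<noteq> x" "dist y x < e" for y
  proof -
    define d where "d = min (dist y x) (e - dist y x)"
    have "d > 0" using y by (simp add: d_def)
    have eq: "g z = g y + (if y < x then l else m) * (z - y)" if "y - d < z" "z < y + d" for z
    proof (cases "y < x")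
      case True
      then have "x - e < z" "z \<le> x" "x - e < y" "y \<le> x"
        using y that by (auto simp: d_def dist_real_def)
      then show ?thesis
        using True e(2)[of y] e(2)[of z] by (simp add: algebra_simps)
    next
      case False
      then have "x \<le> z" "z < x + e" "x \<le> y" "y < x + e"
        using y that by (auto simp: d_def dist_real_def)
      then show ?thesis
        using False e(3)[of y] e(3)[of z] by (simp add: algebra_simps)
    qed
    show ?thesis
      using \<open>d > 0\<close> by (intro kinkI[of d] eq) auto
  qed
  then show ?thesis
    unfolding eventually_at using \<open>e > 0\<close> by blast
qed

lemma kink_self_imp_DERIV:
  assumes "kink g x l l"
  shows "(g has_real_derivative l) (at x)"
proof -
  have "\<forall>\<^sub>F y in nhds x. g x + l * (y - x) = g y"
    using assms by (simp add: kink_def eq_commute)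
  moreover have "((\<lambda>y. g x + l * (y - x)) has_real_derivative l) (at x)"
    by (auto intro!: derivative_eq_intros)
  ultimately show ?thesis
    by (subst (asm) DERIV_cong_ev[OF refl _ refl]) auto
qed

text \<open>Off \<open>x\<close> the derivative near \<open>x\<close> is exactly \<open>l\<close> on the left and \<open>m\<close> on the right, so the limit in
the definition of the slope jump is that of a constant function.\<close>

lemma slope_jump_kink:
  assumes "kink g x l m"
  shows "slope_jump g x = m - l"
proof -
  obtain e where e: "e > 0"
    "\<And>y. y \<noteq> x \<Longrightarrow> dist y x < e \<Longrightarrow> kink g y (if y < x then l else m) (if y < x then l else m)"
    using kink_near[OF assms] unfolding eventually_at by auto
  have "deriv g (x + t) - deriv g (x - t) = m - l" if "0 < t" "t < e" for t
  proof -
    have "kink g (x + t) m m" "kink g (x - t) l l"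
      using e(2)[of "x + t"] e(2)[of "x - t"] that by (auto simp: dist_real_def)
    from this[THEN kink_self_imp_DERIV, THEN DERIV_imp_deriv] show ?thesis
      by simp
  qed
  then have "\<forall>\<^sub>F t in at_right 0. m - l = deriv g (x + t) - deriv g (x - t)"
    unfolding eventually_at_right_field using \<open>e > 0\<close> by force
  then have "((\<lambda>t. deriv g (x + t) - deriv g (x - t)) \<longlongrightarrow> m - l) (at_right 0)"
    by (rule Lim_transform_eventually[OF tendsto_const])
  then show ?thesis
    unfolding slope_jump_def by (intro tendsto_Lim) auto
qed

lemma kink_isCont:
  assumes "kink g x l m"
  shows "isCont g x"
proof -
  have "((\<lambda>y. g x + (if y < x then l else m) * (y - x)) \<longlongrightarrow> g x) (at x)"
  proof -
    have lim: "((\<lambda>y. (if y < x then l else m) * (y - x)) \<longlongrightarrow> 0) (at x)"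
    proof (rule Lim_null_comparison)
      show "\<forall>\<^sub>F y in at x. norm ((if y < x then l else m) * (y - x)) \<le> (\<bar>l\<bar> + \<bar>m\<bar>) * \<bar>y - x\<bar>"
        by (auto simp: abs_mult intro!: always_eventually mult_right_mono)
      show "((\<lambda>y. (\<bar>l\<bar> + \<bar>m\<bar>) * \<bar>y - x\<bar>) \<longlongrightarrow> 0) (at x)"
        by (rule tendsto_eq_intros refl | simp)+
    qed
    show ?thesis
      using tendsto_add[OF tendsto_const lim, of "g x"] by simp
  qed
  moreover have "\<forall>\<^sub>F y in at x. g x + (if y < x then l else m) * (y - x) = g y"
    using assms unfolding kink_def eventually_nhds_conv_at by (simp add: eq_commute)
  ultimately show ?thesis
    unfolding isCont_def by (rule Lim_transform_eventually)
qed

lemma locally_pl_continuous: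
  "locally_pl g \<Longrightarrow> continuous_on A g"
  unfolding locally_pl_def by (meson continuous_at_imp_continuous_on kink_isCont)

lemma kink_slope_jump:
  assumes "locally_pl g"
  obtains l where "kink g x l (l + slope_jump g x)"
proof -
  obtain l m where "kink g x l m"
    using assms unfolding locally_pl_def by blast
  then show thesis
    using that[of l] slope_jump_kink[of g x l m] by simp
qed

text \<open>Next to any kink the function is affine, so nonzero jumps cannot accumulate.\<close>

lemma finite_slope_jumps:
  assumes "locally_pl g"
  shows "finite {x \<in> {u..v}. slope_jump g x \<noteq> 0}" (is "finite ?A")
proof (rule ccontr)
  assume "infinite ?A"
  then have "\<exists>x\<in>{u..v}. x islimpt ?A"
    by (rule Heine_Borel_imp_Bolzano_Weierstrass[OF compact_Icc]) auto
  then obtain x where x: "x islimpt ?A" ..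
  obtain l m where "kink g x l m"
    using assms unfolding locally_pl_def by blast
  from kink_near[OF this] have "\<forall>\<^sub>F y in at x. y \<notin> ?A"
  proof eventually_elim
    case (elim y)
    then show ?case using slope_jump_kink[OF elim] by simp
  qed
  with x show False
    by (simp add: islimpt_iff_eventually)
qed

lemma kink_shift:
  assumes "kink g (x + d) l m"
  shows "kink (\<lambda>y. g (y + d)) x l m"
proof -
  obtain e where e: "e > 0" "\<And>y. x + d - e < y \<Longrightarrow> y \<le> x + d \<Longrightarrow> g y = g (x + d) + l * (y - (x + d))"
    "\<And>y. x + d \<le> y \<Longrightarrow> y < x + d + e \<Longrightarrow> g y = g (x + d) + m * (y - (x + d))"
    using kinkD[OF assms] by blast
  show ?thesis
  proof (rule kinkI[OF \<open>e > 0\<close>])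
    show "g (y + d) = g (x + d) + l * (y - x)" if "x - e < y" "y < x" for y
      using e(2)[of "y + d"] that by simp
    show "g (y + d) = g (x + d) + m * (y - x)" if "x < y" "y < x + e" for y
      using e(3)[of "y + d"] that by simp
  qed
qed

lemma kink_add:
  assumes "kink g x l m" "kink h x l' m'"
  shows "kink (\<lambda>y. g y + h y) x (l + l') (m + m')"
  using assms unfolding kink_def
  by eventually_elim (auto simp: algebra_simps)

lemma kink_cmult:
  assumes "kink g x l m"
  shows "kink (\<lambda>y. k * g y) x (k * l) (k * m)"
  using assms unfolding kink_def
proof eventually_elim
  case (elim y)
  show ?case
    by (subst elim) (simp add: algebra_simps)
qed

lemma kink_const: "kink (\<lambda>y. k) x 0 0"
  by (simp add: kink_def)

lemma kink_max_zero:
  "kink (\<lambda>y. max 0 (y - s)) x (if s < x then 1 else 0) (if s \<le> x then 1 else 0)"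
proof (cases "x = s")
  case True
  then show ?thesis by (intro kinkI[of 1]) auto
next
  case False
  then show ?thesis by (intro kinkI[of "\<bar>x - s\<bar>"]) auto
qed

text \<open>Where the two functions agree at \<open>x\<close>, the maximum follows the smaller slope on the left of \<open>x\<close> and the
larger one on the right; elsewhere one of the functions dominates near \<open>x\<close>.\<close>

lemma kink_max:
  assumes g: "kink g x l m" and h: "kink h x l' m'"
  shows "\<exists>l m. kink (\<lambda>y. max (g y) (h y)) x l m"
proof (cases "g x" "h x" rule: linorder_cases)
  case equal
  have "kink (\<lambda>y. max (g y) (h y)) x (min l l') (max m m')"
    using g h unfolding kink_def
  proof eventually_elim
    case (elim y)
    show ?case
      using elim equal mult_right_mono[of m m' "y - x"] mult_right_mono[of m' m "y - x"]
        mult_right_mono_neg[of l l' "y - x"] mult_right_mono_neg[of l' l "y - x"]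
      by (auto simp: max_def min_def)
  qed
  then show ?thesis by blast
next
  case less
  have "\<forall>\<^sub>F y in nhds x. g y < h y"
    using order_tendstoD(1)[of "\<lambda>y. h y - g y" "h x - g x" "nhds x" 0] less
      kink_isCont[OF g] kink_isCont[OF h]
    by (auto simp: isCont_def tendsto_at_iff_tendsto_nhds intro!: tendsto_diff)
  then have "kink (\<lambda>y. max (g y) (h y)) x l' m'"
    using h unfolding kink_def by eventually_elim (use less in simp)
  then show ?thesis by blast
next
  case greater
  have "\<forall>\<^sub>F y in nhds x. h y < g y"
    using order_tendstoD(1)[of "\<lambda>y. g y - h y" "g x - h x" "nhds x" 0] greater
      kink_isCont[OF g] kink_isCont[OF h]
    by (auto simp: isCont_def tendsto_at_iff_tendsto_nhds intro!: tendsto_diff)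
  then have "kink (\<lambda>y. max (g y) (h y)) x l m"
    using g unfolding kink_def by eventually_elim (use greater in simp)
  then show ?thesis by blast
qed

lemma locally_plD: "locally_pl g \<Longrightarrow> \<exists>l m. kink g x l m"
  by (simp add: locally_pl_def)

lemma locally_pl_add:
  assumes "locally_pl g" "locally_pl h"
  shows "locally_pl (\<lambda>y. g y + h y)"
  unfolding locally_pl_def
proof
  fix x
  obtain l m l' m' where "kink g x l m" "kink h x l' m'"
    using assms locally_plD by blast
  from kink_add[OF this] show "\<exists>l m. kink (\<lambda>y. g y + h y) x l m" by blast
qed

lemma locally_pl_max:
  assumes "locally_pl g" "locally_pl h"
  shows "locally_pl (\<lambda>y. max (g y) (h y))"
  unfolding locally_pl_def
proof
  fix x
  obtain l m l' m' where "kink g x l m" "kink h x l' m'"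
    using assms locally_plD by blast
  from kink_max[OF this] show "\<exists>l m. kink (\<lambda>y. max (g y) (h y)) x l m" .
qed

lemma locally_pl_shift:
  assumes "locally_pl g"
  shows "locally_pl (\<lambda>y. g (y + d))"
  unfolding locally_pl_def
proof
  fix x
  obtain l m where "kink g (x + d) l m"
    using assms locally_plD by blast
  from kink_shift[OF this] show "\<exists>l m. kink (\<lambda>y. g (y + d)) x l m" by blast
qed

lemma locally_pl_const: "locally_pl (\<lambda>y. k)"
  unfolding locally_pl_def using kink_const[of k] by blast

lemma slope_jump_uminus:
  assumes "locally_pl g"
  shows "slope_jump (\<lambda>y. - g y) x = - slope_jump g x"
proof -
  obtain l where "kink g x l (l + slope_jump g x)"
    using kink_slope_jump[OF assms] .
  from slope_jump_kink[OF kink_cmult[OF this, of "-1"]] show ?thesis by simp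
qed

text \<open>A breakpoint set that is finite on compact intervals leaves punctured neighbourhoods free of
breakpoints on both sides of \<open>x\<close>; continuity glues the two affine pieces to the value at \<open>x\<close>.\<close>

lemma trop_meromorphic_locally_pl:
  assumes "trop_meromorphic g"
  shows "locally_pl g"
proof -
  have cont: "isCont g x" for x
    using assms by (auto simp: trop_meromorphic_def continuous_on_eq_continuous_at)
  obtain S where S: "\<And>u v. finite (S \<inter> {u..v})"
    "\<And>u v. {u<..<v} \<inter> S = {} \<Longrightarrow> \<exists>m b. \<forall>x\<in>{u<..<v}. g x = m * x + b"
    using assms by (auto simp: trop_meromorphic_def piecewise_linear_def)
  have one_side: "\<exists>m. \<forall>y\<in>{u<..<v}. g y = g x + m * (y - x)"
    if x: "x = u \<or> x = v" and "u < v" and free: "{u<..<v} \<inter> S = {}" for u v x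
  proof -
    obtain m b where mb: "\<And>y. y \<in> {u<..<v} \<Longrightarrow> g y = m * y + b"
      using S(2)[OF free] by blast
    have "g y - (m * y + b) = 0" if "y \<in> {u..v}" for y
    proof (rule continuous_constant_on_closure[where S = "{u<..<v}"
          and f = "\<lambda>y. g y - (m * y + b)" and a = 0])
      show "continuous_on (closure {u<..<v}) (\<lambda>y. g y - (m * y + b))"
        using cont by (auto intro!: continuous_intros continuous_at_imp_continuous_on)
      show "y \<in> closure {u<..<v}"
        using that \<open>u < v\<close> by simp
    qed (use mb in auto)
    from this[of x] have "g x = m * x + b"
      using x \<open>u < v\<close> by auto
    with mb show ?thesis
      by (intro exI[of _ m]) (auto simp: algebra_simps)
  qed
  have "\<exists>l m. kink g x l m" for x
  proof -
    obtain e where e: "e > 0" "\<And>s. s \<in> S \<inter> {x - 1..x + 1} \<Longrightarrow> s \<noteq> x \<Longrightarrow> e \<le> dist x s"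
      using finite_set_avoid[OF S(1), of "x - 1" "x + 1" x] by metis
    define d where "d = min e 1"
    have "d > 0" using e by (simp add: d_def)
    have free: "{x - d<..<x} \<inter> S = {}" "{x<..<x + d} \<inter> S = {}"
      using e(2) by (fastforce simp: d_def dist_real_def)+
    from one_side[OF _ _ free(1), of x] one_side[OF _ _ free(2), of x] \<open>d > 0\<close>
    obtain l m where "\<forall>y\<in>{x - d<..<x}. g y = g x + l * (y - x)"
      "\<forall>y\<in>{x<..<x + d}. g y = g x + m * (y - x)"
      by auto
    then have "kink g x l m"
      using \<open>d > 0\<close> by (intro kinkI[of d]) auto
    then show ?thesis by blast
  qed
  then show ?thesis by (simp add: locally_pl_def)
qed

text \<open>Each kink contributes the elementary function \<open>max 0 (x - s)\<close>, weighted by the jump at \<open>s\<close>. After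
these contributions are subtracted no jump is left, so that what remains is locally affine, hence
affine on the whole interval. This is the tropical analogue of factoring out zeros and poles, and it
yields both convexity and the Jensen formula.\<close>

lemma locally_pl_representation:
  assumes g: "locally_pl g" and "u < v"
  shows "\<exists>\<alpha> \<beta>. \<forall>x\<in>{u<..<v}.
    g x = \<alpha> + \<beta> * x + (\<Sum>s | s \<in> {u..v} \<and> slope_jump g s \<noteq> 0. slope_jump g s * max 0 (x - s))"
proof -
  define K where "K = {s \<in> {u..v}. slope_jump g s \<noteq> 0}"
  define \<phi> where "\<phi> x = (\<Sum>s\<in>K. - slope_jump g s * max 0 (x - s))" for x
  define h where "h x = g x + \<phi> x" for x
  have "finite K"
    unfolding K_def by (rule finite_slope_jumps[OF g])
  have \<phi>: "kink \<phi> x (\<Sum>s\<in>K. - slope_jump g s * (if s < x then 1 else 0))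
      (\<Sum>s\<in>K. - slope_jump g s * (if s \<le> x then 1 else 0))" for x
    unfolding \<phi>_def using \<open>finite K\<close>
  proof (induction K)
    case empty
    show ?case using kink_const by simp
  next
    case (insert s K)
    then show ?case
      using kink_add[OF kink_cmult[OF kink_max_zero, of "- slope_jump g s" s x] insert.IH] by simp
  qed
  have "\<exists>l. kink h x l l" if x: "x \<in> {u<..<v}" for x
  proof -
    obtain l where l: "kink g x l (l + slope_jump g x)"
      using kink_slope_jump[OF g] .
    have "(\<Sum>s\<in>K. - slope_jump g s * (if s \<le> x then 1 else 0)) =
        (\<Sum>s\<in>K. - slope_jump g s * (if s < x then 1 else 0) + (if s = x then - slope_jump g s else 0))"
      by (intro sum.cong) auto
    also have "\<dots> = (\<Sum>s\<in>K. - slope_jump g s * (if s < x then 1 else 0)) - slope_jump g x"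
      using x \<open>finite K\<close> by (subst sum.distrib) (auto simp: sum.delta K_def)
    finally have "kink h x (l + (\<Sum>s\<in>K. - slope_jump g s * (if s < x then 1 else 0)))
        (l + (\<Sum>s\<in>K. - slope_jump g s * (if s < x then 1 else 0)))"
      unfolding h_def using kink_add[OF l \<phi>[of x]] by simp
    then show ?thesis by blast
  qed
  then obtain D where D: "kink h x (D x) (D x)" if "x \<in> {u<..<v}" for x
    by metis
  \<comment> \<open>The slope of \<open>h\<close> is locally constant, hence constant on the interval.\<close>
  have "(D has_real_derivative 0) (at x within {u<..<v})" if x: "x \<in> {u<..<v}" for x
  proof -
    have "\<forall>\<^sub>F y in at x. D x = D y"
    proof -
      have "\<forall>\<^sub>F y in at x. y \<in> {u<..<v}"
        using x by (intro eventually_at_in_open') auto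
      with kink_near[OF D[OF x]] show ?thesis
      proof eventually_elim
        case (elim y)
        then show ?case
          by (intro DERIV_unique[of h _ y]) (auto intro!: kink_self_imp_DERIV D split: if_splits)
      qed
    qed
    then have "\<forall>\<^sub>F y in nhds x. D x = D y"
      by (simp add: eventually_nhds_conv_at)
    then have "(D has_real_derivative 0) (at x)"
      using DERIV_cong_ev[of x x "\<lambda>_. D x" D 0 0] by simp
    then show ?thesis
      by (rule has_field_derivative_at_within)
  qed
  then obtain \<beta> where \<beta>: "\<And>x. x \<in> {u<..<v} \<Longrightarrow> D x = \<beta>"
    using has_field_derivative_zero_constant[of "{u<..<v}" D] by auto
  have "((\<lambda>x. h x - \<beta> * x) has_real_derivative 0) (at x within {u<..<v})" if x: "x \<in> {u<..<v}" for x
    by (rule has_field_derivative_at_within)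
      (use kink_self_imp_DERIV[OF D[OF x]] \<beta>[OF x] in \<open>auto intro!: derivative_eq_intros\<close>)
  then obtain \<alpha> where "\<And>x. x \<in> {u<..<v} \<Longrightarrow> h x - \<beta> * x = \<alpha>"
    using has_field_derivative_zero_constant[of "{u<..<v}" "\<lambda>x. h x - \<beta> * x"] by auto
  then have "g x = \<alpha> + \<beta> * x + (\<Sum>s\<in>K. slope_jump g s * max 0 (x - s))" if "x \<in> {u<..<v}" for x
    using that unfolding h_def \<phi>_def by (force simp: sum_negf)
  then show ?thesis
    unfolding K_def by blast
qed

section \<open>Convexity and the tropical Jensen formula\<close>

text \<open>The class of tropical entire functions, characterised by convexity instead of by the absence of poles.\<close>

definition trop_convex :: "(real \<Rightarrow> real) \<Rightarrow> bool" where
  "trop_convex g \<longleftrightarrow> locally_pl g \<and> convex_on UNIV g"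

text \<open>Compare \<open>g x\<close> with the mean of \<open>g\<close> at two symmetric points so close to \<open>x\<close> that both lie on the affine
pieces adjacent to \<open>x\<close>.\<close>

lemma slope_jump_nonneg:
  assumes "trop_convex g"
  shows "slope_jump g x \<ge> 0"
proof -
  obtain l m where k: "kink g x l m"
    using assms locally_plD unfolding trop_convex_def by blast
  obtain e where e: "e > 0" "\<And>y. x - e < y \<Longrightarrow> y \<le> x \<Longrightarrow> g y = g x + l * (y - x)"
    "\<And>y. x \<le> y \<Longrightarrow> y < x + e \<Longrightarrow> g y = g x + m * (y - x)"
    using kinkD[OF k] by blast
  define d where "d = e / 2"
  have d: "0 < d" "d < e" using e(1) by (auto simp: d_def)
  have "g x \<le> (1 - 1/2) * g (x - d) + 1/2 * g (x + d)"
    using convex_onD[of UNIV g "1/2" "x - d" "x + d"] assms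
    by (simp add: trop_convex_def field_simps)
  also have "g (x - d) = g x - l * d"
    using e(2)[of "x - d"] d by simp
  also have "g (x + d) = g x + m * d"
    using e(3)[of "x + d"] d by simp
  finally have "l * d \<le> m * d" by argo
  then show ?thesis
    using d slope_jump_kink[OF k] by simp
qed

text \<open>In the representation by kinks, nonnegative jumps make the function a nonnegative combination of the
convex functions \<open>max 0 (x - s)\<close> plus an affine one.\<close>

lemma trop_convexI:
  assumes g: "locally_pl g" and J: "\<And>x. slope_jump g x \<ge> 0"
  shows "trop_convex g"
proof -
  have "g ((1 - t) * x + t * y) \<le> (1 - t) * g x + t * g y" if t: "0 < t" "t < 1" for t x y
  proof -
    define u v where "u = min x y - 1" and "v = max x y + 1"
    define K where "K = {s. s \<in> {u..v} \<and> slope_jump g s \<noteq> 0}"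
    have "u < v" by (auto simp: u_def v_def)
    obtain \<alpha> \<beta> where rep: "\<And>x. x \<in> {u<..<v} \<Longrightarrow>
        g x = \<alpha> + \<beta> * x + (\<Sum>s\<in>K. slope_jump g s * max 0 (x - s))"
      using locally_pl_representation[OF g \<open>u < v\<close>] unfolding K_def by blast
    have xy: "x \<in> {u<..<v}" "y \<in> {u<..<v}" by (auto simp: u_def v_def)
    then have z: "(1 - t) * x + t * y \<in> {u<..<v}"
      using convexD_alt[of "{u<..<v}" x y t] t by simp
    have kink: "max 0 ((1 - t) * x + t * y - s) \<le> (1 - t) * max 0 (x - s) + t * max 0 (y - s)" for s
    proof -
      have "(1 - t) * (x - s) \<le> (1 - t) * max 0 (x - s)" "t * (y - s) \<le> t * max 0 (y - s)"
        using t by (auto intro!: mult_left_mono)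
      moreover have "0 \<le> (1 - t) * max 0 (x - s)" "0 \<le> t * max 0 (y - s)"
        using t by auto
      moreover have "(1 - t) * x + t * y - s = (1 - t) * (x - s) + t * (y - s)"
        by (simp add: algebra_simps)
      ultimately show ?thesis by linarith
    qed
    have "(\<Sum>s\<in>K. slope_jump g s * max 0 ((1 - t) * x + t * y - s))
        \<le> (\<Sum>s\<in>K. slope_jump g s * ((1 - t) * max 0 (x - s) + t * max 0 (y - s)))"
      using J kink by (intro sum_mono mult_left_mono)
    also have "\<dots> = (1 - t) * (\<Sum>s\<in>K. slope_jump g s * max 0 (x - s))
        + t * (\<Sum>s\<in>K. slope_jump g s * max 0 (y - s))"
      by (simp add: sum_distrib_left sum.distrib[symmetric] algebra_simps)
    finally show ?thesis
      unfolding rep[OF xy(1)] rep[OF xy(2)] rep[OF z] by (simp add: algebra_simps)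
  qed
  then show ?thesis
    using g by (auto simp: trop_convex_def intro!: convex_onI)
qed

lemma trop_entire_trop_convex:
  assumes "trop_entire g"
  shows "trop_convex g"
  using assms trop_meromorphic_locally_pl[of g]
  by (auto simp: trop_entire_def trop_pole_def not_less intro!: trop_convexI)

lemma trop_convex_add: "trop_convex g \<Longrightarrow> trop_convex h \<Longrightarrow> trop_convex (\<lambda>x. g x + h x)"
  by (auto simp: trop_convex_def locally_pl_add)

lemma convex_on_max:
  fixes g h :: "real \<Rightarrow> real"
  assumes "convex_on UNIV g" "convex_on UNIV h"
  shows "convex_on UNIV (\<lambda>x. max (g x) (h x))"
proof (rule convex_onI)
  fix t x y :: real assume t: "0 < t" "t < 1"
  have "g ((1 - t) *\<^sub>R x + t *\<^sub>R y) \<le> (1 - t) * g x + t * g y"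
    "h ((1 - t) *\<^sub>R x + t *\<^sub>R y) \<le> (1 - t) * h x + t * h y"
    using convex_onD[OF assms(1), of t x y] convex_onD[OF assms(2), of t x y] t by auto
  moreover have "(1 - t) * g x \<le> (1 - t) * max (g x) (h x)" "t * g y \<le> t * max (g y) (h y)"
    "(1 - t) * h x \<le> (1 - t) * max (g x) (h x)" "t * h y \<le> t * max (g y) (h y)"
    using t by (auto intro!: mult_left_mono)
  ultimately show "max (g ((1 - t) *\<^sub>R x + t *\<^sub>R y)) (h ((1 - t) *\<^sub>R x + t *\<^sub>R y))
      \<le> (1 - t) * max (g x) (h x) + t * max (g y) (h y)"
    by linarith
qed simp

lemma trop_convex_max: "trop_convex g \<Longrightarrow> trop_convex h \<Longrightarrow> trop_convex (\<lambda>x. max (g x) (h x))"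
  by (auto simp: trop_convex_def locally_pl_max convex_on_max)

lemma trop_convex_const: "trop_convex (\<lambda>x. k)"
  by (auto simp: trop_convex_def locally_pl_const convex_on_const)

lemma trop_convex_shift:
  assumes "trop_convex g"
  shows "trop_convex (\<lambda>x. g (x + d))"
proof -
  have "g ((1 - t) * x + t * y + d) \<le> (1 - t) * g (x + d) + t * g (y + d)" if "0 < t" "t < 1" for t x y
  proof -
    have "(1 - t) * x + t * y + d = (1 - t) * (x + d) + t * (y + d)"
      by (simp add: algebra_simps)
    then show ?thesis
      using convex_onD[of UNIV g t "x + d" "y + d"] assms that by (simp add: trop_convex_def)
  qed
  then show ?thesis
    using assms by (auto simp: trop_convex_def locally_pl_shift intro!: convex_onI)
qed

lemma trop_convex_sum:
  "finite I \<Longrightarrow> (\<And>i. i \<in> I \<Longrightarrow> trop_convex (g i)) \<Longrightarrow> trop_convex (\<lambda>x. \<Sum>i\<in>I. g i x)"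
  by (induction I rule: finite_induct) (auto intro: trop_convex_const trop_convex_add)

text \<open>Tropical linear forms and the Casorati determinant are both finite maxima, so this lemma makes the
Jensen formula available for them.\<close>

lemma trop_convex_Max:
  assumes "finite I" "I \<noteq> {}" "\<And>i. i \<in> I \<Longrightarrow> trop_convex (g i)"
  shows "trop_convex (\<lambda>x. Max ((\<lambda>i. g i x) ` I))"
  using assms
proof (induction I rule: finite_ne_induct)
  case (singleton i)
  then show ?case by simp
next
  case (insert i I)
  then show ?case by (simp add: trop_convex_max)
qed

lemma has_integral_step:
  fixes a r :: real
  assumes "0 \<le> a" "0 \<le> r"
  shows "((\<lambda>t. if a \<le> t then k else 0) has_integral k * max 0 (r - a)) {0..r}"
proof (cases "a \<le> r")
  case True
  have "((\<lambda>t. k) has_integral k * (r - a)) {a..r}"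
    using has_integral_const_real[of k a r] True by (simp add: mult.commute)
  moreover have "{a..r} \<subseteq> {0..r}" using assms by auto
  ultimately have "((\<lambda>t. if t \<in> {a..r} then k else 0) has_integral k * (r - a)) {0..r}"
    by (simp only: has_integral_restrict)
  from has_integral_eq[OF _ this, of "\<lambda>t. if a \<le> t then k else 0"] show ?thesis
    using True by simp
next
  case False
  then show ?thesis
    by (auto intro!: has_integral_is_0)
qed

text \<open>The tropical Jensen formula. A kink at \<open>s\<close> of jump \<open>J\<close> contributes \<open>J * max 0 (r - \<bar>s\<bar>) / 2\<close> to either
side: on the left because it is counted for \<open>t\<close> from \<open>\<bar>s\<bar>\<close> to \<open>r\<close>, on the right by evaluating
\<open>max 0 (x - s)\<close> at \<open>r\<close>, \<open>- r\<close> and \<open>0\<close>.\<close>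

lemma trop_Jensen:
  assumes g: "trop_convex g" and "0 \<le> r"
  shows "counting_fun r (trop_inverse g) = (g r + g (- r)) / 2 - g 0"
proof -
  define K where "K = {s. s \<in> {- r - 1..r + 1} \<and> slope_jump g s \<noteq> 0}"
  have pl: "locally_pl g" using g by (simp add: trop_convex_def)
  have "finite K"
    using finite_slope_jumps[OF pl] by (simp add: K_def)
  have inv: "trop_inverse g = (\<lambda>x. - g x)"
    by (simp add: trop_inverse_def fun_eq_iff)
  have jump: "slope_jump (trop_inverse g) s = - slope_jump g s" for s
    unfolding inv by (rule slope_jump_uminus[OF pl])
  have count: "pole_count t (trop_inverse g) = (\<Sum>s\<in>K. if \<bar>s\<bar> \<le> t then slope_jump g s else 0)"
    if "t \<in> {0..r}" for t
  proof -
    have "{s. \<bar>s\<bar> \<le> t \<and> trop_pole (trop_inverse g) s} = K \<inter> {s. \<bar>s\<bar> \<le> t}"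
      using that slope_jump_nonneg[OF g] by (force simp: trop_pole_def jump K_def less_le)
    then show ?thesis
      unfolding pole_count_def using \<open>finite K\<close> slope_jump_nonneg[OF g]
      by (simp add: sum.inter_restrict jump if_distrib cong: if_cong)
  qed
  have "((\<lambda>t. \<Sum>s\<in>K. if \<bar>s\<bar> \<le> t then slope_jump g s else 0) has_integral
      (\<Sum>s\<in>K. slope_jump g s * max 0 (r - \<bar>s\<bar>))) {0..r}"
    using \<open>finite K\<close> \<open>0 \<le> r\<close> by (intro has_integral_sum has_integral_step) auto
  from has_integral_eq[OF _ this, of "\<lambda>t. pole_count t (trop_inverse g)"]
  have "((\<lambda>t. pole_count t (trop_inverse g)) has_integral
      (\<Sum>s\<in>K. slope_jump g s * max 0 (r - \<bar>s\<bar>))) {0..r}"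
    using count by simp
  then have N: "counting_fun r (trop_inverse g) = (\<Sum>s\<in>K. slope_jump g s * max 0 (r - \<bar>s\<bar>)) / 2"
    unfolding counting_fun_def by (simp add: integral_unique)
  \<comment> \<open>The representation holds on an open interval only; the margin \<open>1\<close> keeps \<open>\<plusminus>r\<close> inside.\<close>
  have "- r - 1 < r + 1" using \<open>0 \<le> r\<close> by simp
  then obtain \<alpha> \<beta> where rep: "\<And>x. x \<in> {- r - 1<..<r + 1} \<Longrightarrow>
      g x = \<alpha> + \<beta> * x + (\<Sum>s\<in>K. slope_jump g s * max 0 (x - s))"
    using locally_pl_representation[OF pl] unfolding K_def by blast
  have "g r + g (- r) - 2 * g 0 = (\<Sum>s\<in>K. slope_jump g s * max 0 (r - s))
      + (\<Sum>s\<in>K. slope_jump g s * max 0 (- r - s)) - 2 * (\<Sum>s\<in>K. slope_jump g s * max 0 (- s))"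
    using rep[of r] rep[of "- r"] rep[of 0] \<open>0 \<le> r\<close> by simp
  also have "\<dots> = (\<Sum>s\<in>K. slope_jump g s * (max 0 (r - s) + max 0 (- r - s) - 2 * max 0 (- s)))"
    by (simp add: sum_distrib_left sum.distrib sum_subtractf algebra_simps)
  also have "\<dots> = (\<Sum>s\<in>K. slope_jump g s * max 0 (r - \<bar>s\<bar>))"
    using \<open>0 \<le> r\<close> by (intro sum.cong refl arg_cong2[of _ _ _ _ "(*)"]) auto
  finally have "(\<Sum>s\<in>K. slope_jump g s * max 0 (r - \<bar>s\<bar>)) = g r + g (- r) - 2 * g 0" ..
  then show ?thesis
    unfolding N by simp
qed

section \<open>General position and finite matchings\<close>

lemma sum_ereal_eq_MInfty_iff:
  fixes v :: "'a \<Rightarrow> ereal"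
  assumes "finite I" "\<And>i. i \<in> I \<Longrightarrow> v i \<noteq> \<infinity>"
  shows "sum v I = - \<infinity> \<longleftrightarrow> (\<exists>i\<in>I. v i = - \<infinity>)"
  using assms
proof (induction I rule: finite_induct)
  case (insert i I)
  then have "sum v I \<noteq> \<infinity>" by (auto simp: sum_Pinfty)
  with insert show ?case by (cases "v i"; cases "sum v I") auto
qed simp

text \<open>The contrapositive of what general position is needed for: if no permutation picks finite entries
only, that is, if the tropical determinant of \<open>A\<close> is \<open>- \<infinity>\<close>, then the \<open>n + 1\<close> hyperplanes meet.

The common point comes from a tropical Cramer rule. Take a maximal set \<open>R\<close> of rows that can be matched
injectively to columns with finite entries, and a set \<open>L\<close> consisting of the matched columns and one
more. The coordinate \<open>x i\<close> for \<open>i \<in> L\<close> is the maximal minor of the rows \<open>R\<close> with column \<open>i\<close> left out of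
\<open>L\<close>; all other coordinates are \<open>- \<infinity>\<close>. For a row \<open>r \<in> R\<close>, the maximum of \<open>A r i + x i\<close> is the tropical
determinant of the matrix in which row \<open>r\<close> occurs twice; exchanging the two copies shows that it is
attained twice. For a row \<open>r \<notin> R\<close>, any finite value of \<open>A r i + x i\<close> would give a larger set of matched
rows, so all the terms are \<open>- \<infinity>\<close>.\<close>

lemma common_point_of_unmatched_hyperplanes:
  fixes A :: "nat \<Rightarrow> nat \<Rightarrow> ereal"
  assumes "n \<ge> 1"
    and A: "\<And>r i. r \<in> {0..n} \<Longrightarrow> i \<in> {0..n} \<Longrightarrow> A r i \<noteq> \<infinity>"
    and unmatched: "\<And>\<sigma>. \<sigma> permutes {0..n} \<Longrightarrow> \<exists>r\<in>{0..n}. A r (\<sigma> r) = - \<infinity>"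
  shows "\<exists>x\<in>trop_nonzero_vecs n. \<forall>r\<in>{0..n}. max_attained_twice n (A r) x"
proof -
  define matched where "matched R \<sigma> \<longleftrightarrow> R \<subseteq> {0..n} \<and> \<sigma> \<in> R \<rightarrow> {0..n} \<and> inj_on \<sigma> R \<and>
    (\<forall>r\<in>R. A r (\<sigma> r) \<noteq> - \<infinity>)" for R \<sigma>
  have "{} \<in> {R. \<exists>\<sigma>. matched R \<sigma>}" by (simp add: matched_def)
  moreover have "finite {R. \<exists>\<sigma>. matched R \<sigma>}"
    by (rule finite_subset[of _ "Pow {0..n}"]) (auto simp: matched_def)
  ultimately have "\<exists>R\<in>{R. \<exists>\<sigma>. matched R \<sigma>}. \<forall>R'\<in>{R. \<exists>\<sigma>. matched R \<sigma>}. R \<le> R' \<longrightarrow> R = R'"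
    by (intro finite_has_maximal) auto
  then obtain R where "R \<in> {R. \<exists>\<sigma>. matched R \<sigma>}"
    and R_max: "\<forall>R'\<in>{R. \<exists>\<sigma>. matched R \<sigma>}. R \<le> R' \<longrightarrow> R = R'" ..
  then obtain \<sigma>\<^sub>0 where R: "matched R \<sigma>\<^sub>0" by auto
  have maximal: "R = R'" if "matched R' \<sigma>" "R \<subseteq> R'" for R' \<sigma>
    using R_max that by auto
  have "finite R" using R finite_subset by (auto simp: matched_def)
  have "R \<noteq> {0..n}"
  proof
    assume "R = {0..n}"
    define \<tau> where "\<tau> k = (if k \<in> {0..n} then \<sigma>\<^sub>0 k else k)" for k
    have inj: "inj_on \<tau> {0..n}" "\<tau> ` {0..n} \<subseteq> {0..n}"
      using R \<open>R = {0..n}\<close> by (auto simp: matched_def \<tau>_def inj_on_def)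
    then have "bij_betw \<tau> {0..n} {0..n}"
      by (simp add: bij_betw_def endo_inj_surj)
    then have "\<tau> permutes {0..n}"
      by (rule bij_imp_permutes) (simp add: \<tau>_def)
    then show False
      using unmatched[of \<tau>] R \<open>R = {0..n}\<close> by (auto simp: matched_def \<tau>_def)
  qed
  then have "R \<subset> {0..n}" using R by (auto simp: matched_def)
  then have "card (\<sigma>\<^sub>0 ` R) < card {0..n}"
    using psubset_card_mono[of "{0..n}" R] card_image_le[OF \<open>finite R\<close>, of \<sigma>\<^sub>0] by simp
  then have "\<not> {0..n} \<subseteq> \<sigma>\<^sub>0 ` R"
    using \<open>finite R\<close> card_mono[of "\<sigma>\<^sub>0 ` R" "{0..n}"] by auto
  then obtain i\<^sub>0 where i\<^sub>0: "i\<^sub>0 \<in> {0..n}" "i\<^sub>0 \<notin> \<sigma>\<^sub>0 ` R" by blast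
  define L where "L = insert i\<^sub>0 (\<sigma>\<^sub>0 ` R)"
  have L: "L \<subseteq> {0..n}" "finite L" "L \<noteq> {}"
    using R i\<^sub>0 \<open>finite R\<close> by (auto simp: L_def matched_def)
  have "card L = card R + 1"
    using i\<^sub>0 R \<open>finite R\<close> by (simp add: L_def matched_def card_image)
  \<comment> \<open>The terms of the minor that leaves out column \<open>i\<close>; \<open>w\<close> is their weight and \<open>D i\<close> the minor.\<close>
  define \<Sigma> where "\<Sigma> i = {\<sigma> \<in> R \<rightarrow>\<^sub>E L. inj_on \<sigma> R \<and> i \<notin> \<sigma> ` R}" for i
  define w where "w \<sigma> = (\<Sum>r\<in>R. A r (\<sigma> r))" for \<sigma>
  have fin: "finite (\<Sigma> i)" for i
    by (rule finite_subset[of _ "R \<rightarrow>\<^sub>E L"])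
      (auto simp: \<Sigma>_def \<open>finite R\<close> \<open>finite L\<close> finite_PiE)
  have ne: "\<Sigma> i \<noteq> {}" if "i \<in> L" for i
  proof -
    have "card R = card (L - {i})"
      using that \<open>card L = card R + 1\<close> \<open>finite L\<close> by simp
    then obtain \<sigma> where "bij_betw \<sigma> R (L - {i})"
      using finite_same_card_bij[of R "L - {i}"] \<open>finite R\<close> \<open>finite L\<close> by auto
    then have "restrict \<sigma> R \<in> \<Sigma> i"
      by (auto simp: \<Sigma>_def bij_betw_def inj_on_def)
    then show ?thesis by blast
  qed
  define D where "D i = Max (w ` \<Sigma> i)" for i
  have D_ge: "w \<sigma> \<le> D i" if "\<sigma> \<in> \<Sigma> i" for \<sigma> i
    unfolding D_def using fin that by (intro Max_ge) auto
  have D_attained: "\<exists>\<sigma>\<in>\<Sigma> i. D i = w \<sigma>" if "i \<in> L" for i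
  proof -
    have "Max (w ` \<Sigma> i) \<in> w ` \<Sigma> i"
      using fin ne[OF that] by (intro Max_in) auto
    then show ?thesis by (auto simp: D_def)
  qed
  have A': "A r (\<sigma> r) \<noteq> \<infinity>" if "\<sigma> \<in> \<Sigma> i" "r \<in> R" for \<sigma> i r
  proof -
    have "\<sigma> r \<in> L" using that by (auto simp: \<Sigma>_def)
    moreover have "r \<in> {0..n}" using that(2) R by (auto simp: matched_def)
    ultimately show ?thesis using A L(1) by blast
  qed
  have D_fin: "D i \<noteq> \<infinity>" if i: "i \<in> L" for i
  proof -
    obtain \<sigma> where \<sigma>: "\<sigma> \<in> \<Sigma> i" "D i = w \<sigma>" using D_attained[OF i] by blast
    have "w \<sigma> \<noteq> \<infinity>"
      unfolding w_def sum_Pinfty using A'[OF \<sigma>(1)] by blast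
    then show ?thesis using \<sigma>(2) by simp
  qed
  define x where "x i = (if i \<in> L then D i else if i \<in> {0..n} then - \<infinity> else undefined)" for i
  have "D i\<^sub>0 \<noteq> - \<infinity>"
  proof -
    have mem: "restrict \<sigma>\<^sub>0 R \<in> \<Sigma> i\<^sub>0"
      using R i\<^sub>0 by (auto simp: \<Sigma>_def L_def matched_def inj_on_def)
    have "w (restrict \<sigma>\<^sub>0 R) \<noteq> - \<infinity>"
      using R A'[OF mem] \<open>finite R\<close>
      unfolding w_def by (subst sum_ereal_eq_MInfty_iff) (auto simp: matched_def)
    then show ?thesis using D_ge[OF mem] by auto
  qed
  then have "x \<in> trop_nonzero_vecs n"
    unfolding trop_nonzero_vecs_def
  proof (intro CollectI conjI PiE_I)
    show "\<exists>i\<in>{0..n}. x i \<noteq> - \<infinity>"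
      using \<open>D i\<^sub>0 \<noteq> - \<infinity>\<close> i\<^sub>0(1) by (intro bexI[of _ i\<^sub>0]) (auto simp: x_def L_def)
    show "x i = undefined" if "i \<notin> {0..n}" for i
      using that L(1) by (auto simp: x_def)
    show "x i \<in> tropicals" if "i \<in> {0..n}" for i
      using that D_fin by (auto simp: x_def tropicals_def)
  qed
  moreover have "max_attained_twice n (A r) x" if r: "r \<in> {0..n}" for r
  proof -
    have off: "A r i + x i = - \<infinity>" if "i \<in> {0..n}" "i \<notin> L" for i
      using that A[OF r, of i] by (cases "A r i") (auto simp: x_def)
    have "Max ((\<lambda>i. A r i + x i) ` L) \<in> (\<lambda>i. A r i + x i) ` L"
      using L by (intro Max_in) auto
    then obtain i\<^sub>1 where i\<^sub>1: "i\<^sub>1 \<in> L" "A r i\<^sub>1 + x i\<^sub>1 = Max ((\<lambda>i. A r i + x i) ` L)"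
      by auto
    then have top: "A r i + x i \<le> A r i\<^sub>1 + x i\<^sub>1" if "i \<in> {0..n}" for i
    proof (cases "i \<in> L")
      case True
      then show ?thesis unfolding i\<^sub>1(2) using L(2) by (intro Max_ge) auto
    next
      case False
      show ?thesis unfolding off[OF that False] by simp
    qed
    have lin: "trop_linear n (A r) x = A r i\<^sub>1 + x i\<^sub>1"
      unfolding trop_linear_def using top i\<^sub>1(1) L by (intro Max_eqI) auto
    obtain \<sigma> where \<sigma>: "\<sigma> \<in> \<Sigma> i\<^sub>1" "D i\<^sub>1 = w \<sigma>"
      using D_attained[OF i\<^sub>1(1)] by blast
    show ?thesis
    proof (cases "r \<in> R")
      case True
      \<comment> \<open>The second index at which the maximum is attained, obtained by exchanging the copies of row \<open>r\<close>.\<close>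
      define i\<^sub>2 where "i\<^sub>2 = \<sigma> r"
      define s where "s = (\<Sum>r'\<in>R - {r}. A r' (\<sigma> r'))"
      have i\<^sub>2: "i\<^sub>2 \<in> L" "i\<^sub>2 \<noteq> i\<^sub>1"
        using \<sigma>(1) True by (auto simp: \<Sigma>_def i\<^sub>2_def)
      have \<sigma>': "\<sigma> \<in> R \<rightarrow>\<^sub>E L" "inj_on \<sigma> R" "i\<^sub>1 \<notin> \<sigma> ` R"
        using \<sigma>(1) by (simp_all add: \<Sigma>_def)
      have "\<sigma>(r := i\<^sub>1) \<in> R \<rightarrow>\<^sub>E L"
      proof (rule PiE_I)
        show "(\<sigma>(r := i\<^sub>1)) r' \<in> L" if "r' \<in> R" for r'
          using that \<sigma>'(1) i\<^sub>1(1) by (cases "r' = r") auto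
        show "(\<sigma>(r := i\<^sub>1)) r' = undefined" if "r' \<notin> R" for r'
        proof -
          have "r' \<noteq> r" using that True by blast
          then show ?thesis using PiE_arb[OF \<sigma>'(1) that] by simp
        qed
      qed
      moreover have "inj_on (\<sigma>(r := i\<^sub>1)) R"
        by (rule inj_on_fun_updI[OF \<sigma>'(2,3)])
      moreover have "i\<^sub>2 \<notin> (\<sigma>(r := i\<^sub>1)) ` R"
      proof
        assume "i\<^sub>2 \<in> (\<sigma>(r := i\<^sub>1)) ` R"
        then obtain r' where r': "r' \<in> R" "i\<^sub>2 = (\<sigma>(r := i\<^sub>1)) r'" by blast
        then have "r' \<noteq> r" using i\<^sub>2(2) by auto
        then show False
          using r' inj_onD[OF \<sigma>'(2), of r' r] True by (simp add: i\<^sub>2_def)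
      qed
      ultimately have "\<sigma>(r := i\<^sub>1) \<in> \<Sigma> i\<^sub>2"
        by (simp add: \<Sigma>_def)
      moreover have "w (\<sigma>(r := i\<^sub>1)) = A r i\<^sub>1 + s"
        unfolding w_def s_def using True \<open>finite R\<close> by (simp add: sum.remove[of R r])
      ultimately have "A r i\<^sub>1 + s \<le> D i\<^sub>2"
        using D_ge by metis
      then have "A r i\<^sub>2 + (A r i\<^sub>1 + s) \<le> A r i\<^sub>2 + D i\<^sub>2"
        by (rule add_left_mono)
      moreover have "D i\<^sub>1 = A r i\<^sub>2 + s"
        unfolding \<sigma>(2) w_def s_def i\<^sub>2_def using True \<open>finite R\<close> by (simp add: sum.remove[of R r])
      ultimately have "A r i\<^sub>1 + x i\<^sub>1 \<le> A r i\<^sub>2 + x i\<^sub>2"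
        using i\<^sub>1(1) i\<^sub>2(1) by (simp add: x_def add.left_commute)
      then have "A r i\<^sub>2 + x i\<^sub>2 = A r i\<^sub>1 + x i\<^sub>1"
        using top[of i\<^sub>2] i\<^sub>2(1) L(1) by (intro antisym) auto
      then show ?thesis
        unfolding max_attained_twice_def lin using i\<^sub>1(1) i\<^sub>2 L(1) by blast
    next
      case False
      have "A r i\<^sub>1 + x i\<^sub>1 = - \<infinity>"
      proof (rule ccontr)
        assume *: "A r i\<^sub>1 + x i\<^sub>1 \<noteq> - \<infinity>"
        then have "A r i\<^sub>1 \<noteq> - \<infinity>" "w \<sigma> \<noteq> - \<infinity>"
          using i\<^sub>1(1) \<sigma>(2) D_fin[OF i\<^sub>1(1)] A[OF r, of i\<^sub>1] L(1)
          by (auto simp: x_def)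
        then have "\<forall>r'\<in>R. A r' (\<sigma> r') \<noteq> - \<infinity>"
          using A'[OF \<sigma>(1)] \<open>finite R\<close>
          by (simp add: w_def sum_ereal_eq_MInfty_iff)
        then have fin': "A r' ((\<sigma>(r := i\<^sub>1)) r') \<noteq> - \<infinity>" if "r' \<in> insert r R" for r'
          using that \<open>A r i\<^sub>1 \<noteq> - \<infinity>\<close> by (cases "r' = r") auto
        have \<sigma>': "\<sigma> \<in> R \<rightarrow>\<^sub>E L" "inj_on \<sigma> R" "i\<^sub>1 \<notin> \<sigma> ` R"
          using \<sigma>(1) by (simp_all add: \<Sigma>_def)
        have "(\<sigma>(r := i\<^sub>1)) r' \<in> {0..n}" if "r' \<in> insert r R" for r'
          using that PiE_mem[OF \<sigma>'(1), of r'] i\<^sub>1(1) L(1) by (cases "r' = r") auto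
        moreover have "inj_on (\<sigma>(r := i\<^sub>1)) (insert r R)"
          using inj_on_fun_updI[OF \<sigma>'(2,3), of r] \<sigma>'(3) False
          by (auto simp: fun_upd_image)
        ultimately have "matched (insert r R) (\<sigma>(r := i\<^sub>1))"
          using R r fin' unfolding matched_def by blast
        from maximal[OF this] show False using False by blast
      qed
      then have "A r i + x i = A r i\<^sub>1 + x i\<^sub>1" if "i \<in> {0..n}" for i
        using top[OF that] by (simp only: ereal_infty_less_eq)
      moreover have "0 \<in> {0..n}" "1 \<in> {0..n}" "0 \<noteq> (1 :: nat)"
        using \<open>n \<ge> 1\<close> by auto
      ultimately show ?thesis
        unfolding max_attained_twice_def lin by blast
    qed
  qed
  ultimately show ?thesis by blast
qed

lemma mem_trop_point: "x \<in> trop_nonzero_vecs n \<Longrightarrow> x \<in> trop_point n x"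
  by (auto simp: trop_point_def trop_proj_rel_def intro!: exI[of _ 0])

lemma trop_point_in_hyperplaneI:
  assumes "x \<in> trop_nonzero_vecs n" "max_attained_twice n a x"
  shows "trop_point n x \<in> trop_hyperplane n a"
  using assms mem_trop_point[OF assms(1)]
  by (auto simp: trop_hyperplane_def trop_proj_space_def trop_point_def quotient_def)

lemma general_position_matching:
  assumes "n \<ge> 1"
    and a: "\<And>j. j \<in> {1..q} \<Longrightarrow> a j \<in> trop_nonzero_vecs n"
    and gp: "general_position n q (\<lambda>j. trop_hyperplane n (a j))"
    and \<mu>: "\<mu> \<in> {0..n} \<rightarrow> {1..q}" "inj_on \<mu> {0..n}"
  shows "\<exists>\<sigma>. \<sigma> permutes {0..n} \<and> (\<forall>k\<in>{0..n}. a (\<mu> k) (\<sigma> k) \<noteq> - \<infinity>)"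
proof (rule ccontr)
  assume no: "\<not> ?thesis"
  have "\<exists>x\<in>trop_nonzero_vecs n. \<forall>k\<in>{0..n}. max_attained_twice n (a (\<mu> k)) x"
  proof (rule common_point_of_unmatched_hyperplanes[OF \<open>n \<ge> 1\<close>])
    fix k i assume "k \<in> {0..n}" "i \<in> {0..n}"
    then have "a (\<mu> k) \<in> trop_nonzero_vecs n" using a \<mu>(1) by blast
    then show "a (\<mu> k) i \<noteq> \<infinity>"
      using \<open>i \<in> {0..n}\<close> by (auto simp: trop_nonzero_vecs_def tropicals_def)
  qed (use no in blast)
  then obtain x where "x \<in> trop_nonzero_vecs n" "\<And>k. k \<in> {0..n} \<Longrightarrow> max_attained_twice n (a (\<mu> k)) x"
    by blast
  then have "trop_point n x \<in> (\<Inter>k\<in>{0..n}. trop_hyperplane n (a (\<mu> k)))"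
    using trop_point_in_hyperplaneI by blast
  then show False
    using gp \<mu> unfolding general_position_def by blast
qed

text \<open>At a coordinate point only the \<open>i\<close>-th term of a linear form can be finite. The maximum is then attained
twice exactly if this term is \<open>- \<infinity>\<close> as well, which gives \<open>n + 1 \<ge> 2\<close> equal terms.\<close>

lemma coordinate_point_in_hyperplane_iff:
  assumes "n \<ge> 1" and a: "a \<in> trop_nonzero_vecs n" and i: "i \<in> {0..n}"
  shows "trop_point n (\<lambda>k\<in>{0..n}. if k = i then 0 else - \<infinity>) \<in> trop_hyperplane n a
    \<longleftrightarrow> a i = - \<infinity>"
proof -
  define e :: "nat \<Rightarrow> ereal" where "e = (\<lambda>k\<in>{0..n}. if k = i then 0 else - \<infinity>)"
  have e: "e \<in> trop_nonzero_vecs n"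
    using i by (auto simp: e_def trop_nonzero_vecs_def tropicals_def)
  have a_fin: "a k \<noteq> \<infinity>" if "k \<in> {0..n}" for k
    using a that by (auto simp: trop_nonzero_vecs_def tropicals_def)
  have "trop_point n e \<in> trop_hyperplane n a" if "a i = - \<infinity>"
  proof (rule trop_point_in_hyperplaneI[OF e])
    have bot: "a k + e k = - \<infinity>" if "k \<in> {0..n}" for k
      using that \<open>a i = - \<infinity>\<close> a_fin[OF that] by (cases "a k") (auto simp: e_def)
    then have "(\<lambda>k. a k + e k) ` {0..n} = {- \<infinity>}" by force
    then have "trop_linear n a e = - \<infinity>" by (simp add: trop_linear_def)
    then show "max_attained_twice n a e"
      unfolding max_attained_twice_def using bot \<open>n \<ge> 1\<close>
      by (intro bexI[of _ 0] bexI[of _ 1]) auto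
  qed
  moreover have "a i = - \<infinity>" if e_in: "trop_point n e \<in> trop_hyperplane n a"
  proof (rule ccontr)
    assume "a i \<noteq> - \<infinity>"
    obtain y where y: "y \<in> trop_point n e" "max_attained_twice n a y"
      using e_in unfolding trop_hyperplane_def by blast
    then obtain l where l: "\<And>k. k \<in> {0..n} \<Longrightarrow> y k = ereal l + e k"
      by (auto simp: trop_point_def trop_proj_rel_def)
    have other: "a k + y k = - \<infinity>" if "k \<in> {0..n}" "k \<noteq> i" for k
      using that a_fin[OF that(1)] l[OF that(1)] by (cases "a k") (auto simp: e_def)
    obtain k where k: "k \<in> {0..n}" "k \<noteq> i" "a k + y k = trop_linear n a y"
      using y(2) unfolding max_attained_twice_def by metis
    have "a i + y i \<le> trop_linear n a y"
      unfolding trop_linear_def using i by (intro Max_ge) auto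
    then have "a i + y i \<le> - \<infinity>"
      using k other[OF k(1,2)] by simp
    moreover have "a i + y i \<noteq> - \<infinity>"
      using l[OF i] i \<open>a i \<noteq> - \<infinity>\<close> a_fin[OF i] by (cases "a i") (auto simp: e_def)
    ultimately show False
      using ereal_infty_less_eq(2) by blast
  qed
  ultimately show ?thesis unfolding e_def by blast
qed

text \<open>The completion of a small family of hyperplanes may be defined by other linear forms than the given
ones. Being matched depends only on which coefficients are finite, and this can be read off the
hyperplane.\<close>

lemma hyperplane_determines_support:
  assumes "n \<ge> 1" "a \<in> trop_nonzero_vecs n" "b \<in> trop_nonzero_vecs n"
    and "trop_hyperplane n a = trop_hyperplane n b" "i \<in> {0..n}"
  shows "a i = - \<infinity> \<longleftrightarrow> b i = - \<infinity>"
  using assms coordinate_point_in_hyperplane_iff by metis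

section \<open>Convex growth, linear forms and the pointwise estimate\<close>

text \<open>The function \<open>r \<mapsto> g r + g (- r)\<close>, twice the mean value in the Jensen formula, is even and convex. It
therefore increases on the positive axis, and at least linearly as soon as it leaves its value at \<open>0\<close>.\<close>

lemma symmetric_sum_mono:
  fixes g :: "real \<Rightarrow> real"
  assumes g: "convex_on UNIV g" and "0 \<le> r" "r \<le> s"
  shows "g r + g (- r) \<le> g s + g (- s)"
proof (cases "s = 0")
  case True
  then show ?thesis using assms by auto
next
  case False
  then have "s > 0" using assms by auto
  define t where "t = (s + r) / (2 * s)"
  have t: "0 \<le> t" "t \<le> 1" using assms \<open>s > 0\<close> by (auto simp: t_def field_simps)
  have r: "(1 - t) * (- s) + t * s = r" using \<open>s > 0\<close> by (simp add: t_def field_simps)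
  have "g r \<le> (1 - t) * g (- s) + t * g s"
    using convex_onD[OF g t, of "- s" s] r by simp
  moreover have "g (- r) \<le> (1 - t) * g s + t * g (- s)"
    using convex_onD[OF g t, of s "- s"] r by (simp add: algebra_simps)
  ultimately show ?thesis by (simp add: algebra_simps)
qed

lemma symmetric_sum_growth:
  fixes g :: "real \<Rightarrow> real"
  assumes g: "convex_on UNIV g" and "0 < r" "r \<le> s"
  shows "(g r + g (- r) - 2 * g 0) / r * s \<le> g s + g (- s) - 2 * g 0"
proof -
  define t where "t = r / s"
  have t: "0 \<le> t" "t \<le> 1" "t > 0" "t * s = r" using assms by (auto simp: t_def field_simps)
  have "g r \<le> (1 - t) * g 0 + t * g s" "g (- r) \<le> (1 - t) * g 0 + t * g (- s)"
    using convex_onD[OF g t(1,2), of 0 s] convex_onD[OF g t(1,2), of 0 "- s"] t(4) by auto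
  then have "g r + g (- r) - 2 * g 0 \<le> t * (g s + g (- s) - 2 * g 0)"
    by (simp add: algebra_simps)
  then have "(g r + g (- r) - 2 * g 0) / t \<le> g s + g (- s) - 2 * g 0"
    using t(3) by (simp add: field_simps)
  moreover have "(g r + g (- r) - 2 * g 0) / r * s = (g r + g (- r) - 2 * g 0) / t"
    using assms by (simp add: t_def)
  ultimately show ?thesis by simp
qed

text \<open>The tropical counterpart of the lemma on the logarithmic derivative. Only upper bounds for
\<open>g (r + d) - g r\<close> are needed. By convexity it suffices to treat \<open>d = \<plusminus>s\<close>. The step to the left costs at
most a constant since the increments of \<open>g\<close> increase; the step to the right is bounded by the increment
of \<open>g r + g (- r)\<close>, again up to a constant, because the slopes of \<open>g\<close> left of \<open>0\<close> are bounded above, so that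
\<open>g (- r)\<close> decreases by at most a constant as \<open>r\<close> grows to \<open>r + s\<close>. Through the symmetric sum, all functions \<open>g\<close> can be controlled by a single one later on.\<close>

lemma convex_shift_le:
  fixes g :: "real \<Rightarrow> real"
  assumes g: "convex_on UNIV g" and "\<bar>d\<bar> \<le> s" "s \<le> r"
  shows "g (r + d) \<le> g r + (g (r + s) + g (- (r + s)) - (g r + g (- r)))
    + (\<bar>g s - g 0\<bar> + \<bar>g (- s) - g 0\<bar>)"
proof (cases "s = 0")
  case True
  then show ?thesis using assms by auto
next
  case False
  then have "s > 0" "r > 0" using assms by auto
  have "convex_on {r - s..r + s} g"
    using convex_on_subset[OF g] by auto
  then have shift: "g (r + d) \<le> max (g (r - s)) (g (r + s))"
    using assms by (intro convex_on_le_max) auto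
  have incr: "g (x + s) - g x \<le> g (y + s) - g y" if "x < y" for x y
  proof -
    define t where "t = s / (y + s - x)"
    have pos: "y + s - x > 0" using that \<open>s > 0\<close> by simp
    have t: "0 \<le> t" "t \<le> 1" using that \<open>s > 0\<close> by (auto simp: t_def)
    have tt: "t * (y + s - x) = s" using pos by (simp add: t_def)
    have "(1 - t) * x + t * (y + s) = x + s" "(1 - t) * (y + s) + t * x = y"
      using tt by (simp_all add: algebra_simps)
    then have "g (x + s) \<le> (1 - t) * g x + t * g (y + s)" "g y \<le> (1 - t) * g (y + s) + t * g x"
      using convex_onD[OF g t, of x "y + s"] convex_onD[OF g t, of "y + s" x] by auto
    then show ?thesis by (simp add: algebra_simps)
  qed
  have "g (0 + s) - g 0 \<le> g (r - s + s) - g (r - s)"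
    using incr[of 0 "r - s"] assms by (cases "r = s") auto
  moreover have "g (- (r + s) + s) - g (- (r + s)) \<le> g (- s + s) - g (- s)"
    using incr[of "- (r + s)" "- s"] \<open>r > 0\<close> by simp
  moreover have "g r + g (- r) \<le> g (r + s) + g (- (r + s))"
    using symmetric_sum_mono[OF g, of r "r + s"] \<open>s > 0\<close> \<open>r > 0\<close> by simp
  ultimately show ?thesis
    using shift by auto
qed

lemma convex_reflect:
  fixes g :: "real \<Rightarrow> real"
  assumes "convex_on UNIV g"
  shows "convex_on UNIV (\<lambda>x. g (- x))"
proof (rule convex_onI)
  fix t x y :: real assume "0 < t" "t < 1"
  then show "g (- ((1 - t) *\<^sub>R x + t *\<^sub>R y)) \<le> (1 - t) * g (- x) + t * g (- y)"
    using convex_onD[OF assms, of t "- x" "- y"] by (simp add: algebra_simps)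
qed simp

text \<open>Up to a constant such a \<open>g\<close> is odd, so the convexity inequalities at \<open>x\<close> and \<open>- x\<close> are opposite to each
other and are equalities.\<close>

lemma affine_of_symmetric_sum_const:
  fixes g :: "real \<Rightarrow> real"
  assumes g: "convex_on UNIV g" and sym: "\<And>x. x > 0 \<Longrightarrow> g x + g (- x) = 2 * g 0"
  shows "g x = g 0 + (g 1 - g 0) * x"
proof -
  have sym': "g x + g (- x) = 2 * g 0" for x
    using sym[of x] sym[of "- x"] by (cases x "0 :: real" rule: linorder_cases) auto
  have scale: "g (t * x) - g 0 = t * (g x - g 0)" if t: "0 \<le> t" "t \<le> 1" for t x
  proof -
    have "g (t * x) \<le> (1 - t) * g 0 + t * g x"
      using convex_onD[OF g t, of 0 x] by simp
    moreover have "g (- (t * x)) \<le> (1 - t) * g 0 + t * g (- x)"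
      using convex_onD[OF g t, of 0 "- x"] by simp
    moreover have "t * g (- x) = 2 * (t * g 0) - t * g x"
      using arg_cong[OF sym'[of x], of "(*) t"] by (simp add: algebra_simps)
    ultimately show ?thesis
      using sym'[of "t * x"] by (simp add: algebra_simps)
  qed
  have pos: "g x - g 0 = x * (g 1 - g 0)" if "x > 0" for x
  proof (cases "x \<le> 1")
    case True
    then show ?thesis using scale[of x 1] that by simp
  next
    case False
    then show ?thesis using scale[of "1 / x" x] that by (simp add: field_simps)
  qed
  show ?thesis
  proof (cases x "0 :: real" rule: linorder_cases)
    case less
    then have "g (- x) - g 0 = - x * (g 1 - g 0)" using pos[of "- x"] by simp
    then show ?thesis using sym'[of x] by (simp add: algebra_simps)
  next
    case greater
    then show ?thesis using pos[of x] by (simp add: algebra_simps)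
  qed simp
qed

lemma nonpos_if_multiples_bounded:
  fixes b C :: real
  assumes "\<And>r. r > 0 \<Longrightarrow> b * r \<le> C"
  shows "b \<le> 0"
proof (rule ccontr)
  assume "\<not> b \<le> 0"
  then have "b * ((\<bar>C\<bar> + 1) / b) \<le> C"
    by (intro assms divide_pos_pos) auto
  then show False using \<open>\<not> b \<le> 0\<close> by simp
qed

lemma curve_norm_ge: "i \<in> {0..n} \<Longrightarrow> f i x \<le> curve_norm n f x"
  unfolding curve_norm_def by (intro Max_ge) auto

lemma curve_norm_attained: "\<exists>i\<in>{0..n}. curve_norm n f x = f i x"
proof -
  have "curve_norm n f x \<in> (\<lambda>i. f i x) ` {0..n}"
    unfolding curve_norm_def by (intro Max_in) auto
  then show ?thesis by auto
qed

lemma trop_convex_curve_norm: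
  assumes "\<And>i. i \<in> {0..n} \<Longrightarrow> trop_convex (f i)"
  shows "trop_convex (curve_norm n f)"
  using trop_convex_Max[of "{0..n}" f] assms by (simp add: curve_norm_def[abs_def])

lemma trop_convex_casorati:
  assumes "\<And>i. i \<in> {0..n} \<Longrightarrow> trop_convex (f i)"
  shows "trop_convex (casorati n c f)"
proof -
  have "id permutes {0..n}" by (rule permutes_id)
  then show ?thesis
    unfolding casorati_def[abs_def] using assms
    by (intro trop_convex_Max trop_convex_sum trop_convex_shift)
      (blast intro: finite_permutations | simp add: finite_permutations)+
qed

text \<open>Terms with coefficient \<open>- \<infinity>\<close> never attain the maximum, since \<open>f\<close> is finite and some coefficient is.\<close>

lemma trop_linear_comp_eq_Max:
  assumes a: "a \<in> trop_nonzero_vecs n"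
  shows "trop_linear_comp n a f x =
    Max ((\<lambda>i. real_of_ereal (a i) + f i x) ` {i \<in> {0..n}. a i \<noteq> - \<infinity>})"
proof -
  let ?I = "{i \<in> {0..n}. a i \<noteq> - \<infinity>}"
  let ?M = "Max ((\<lambda>i. real_of_ereal (a i) + f i x) ` ?I)"
  have I: "finite ?I" "?I \<noteq> {}"
    using a by (auto simp: trop_nonzero_vecs_def)
  have fin: "a i \<noteq> \<infinity>" if "i \<in> {0..n}" for i
    using a that by (auto simp: trop_nonzero_vecs_def tropicals_def)
  have summand: "a i + ereal (f i x) = ereal (real_of_ereal (a i) + f i x)" if "i \<in> ?I" for i
    using that fin[of i] by (cases "a i") auto
  have "?M \<in> (\<lambda>i. real_of_ereal (a i) + f i x) ` ?I"
    using I by (intro Max_in) auto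
  then obtain m where m: "m \<in> ?I" "?M = real_of_ereal (a m) + f m x" by blast
  have "trop_linear n a (\<lambda>i. ereal (f i x)) = ereal ?M"
    unfolding trop_linear_def
  proof (rule Max_eqI)
    fix y assume "y \<in> (\<lambda>i. a i + ereal (f i x)) ` {0..n}"
    then obtain i where i: "i \<in> {0..n}" "y = a i + ereal (f i x)" by blast
    show "y \<le> ereal ?M"
    proof (cases "a i = - \<infinity>")
      case False
      then have "real_of_ereal (a i) + f i x \<le> ?M"
        using I i by (intro Max_ge) auto
      then show ?thesis using summand[of i] i False by simp
    qed (simp add: i)
  next
    show "ereal ?M \<in> (\<lambda>i. a i + ereal (f i x)) ` {0..n}"
      unfolding m(2) using m(1) summand[OF m(1)] by (intro image_eqI[of _ _ m]) auto
  qed simp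
  then show ?thesis by (simp add: trop_linear_comp_def)
qed

lemma trop_linear_comp_ge:
  assumes "a \<in> trop_nonzero_vecs n" "i \<in> {0..n}" "a i \<noteq> - \<infinity>"
  shows "real_of_ereal (a i) + f i x \<le> trop_linear_comp n a f x"
  unfolding trop_linear_comp_eq_Max[OF assms(1)] using assms by (intro Max_ge) auto

lemma trop_linear_comp_le:
  assumes a: "a \<in> trop_nonzero_vecs n"
    and K: "\<And>i. i \<in> {0..n} \<Longrightarrow> \<bar>real_of_ereal (a i)\<bar> \<le> K"
  shows "trop_linear_comp n a f x \<le> curve_norm n f x + K"
proof -
  have "real_of_ereal (a i) + f i x \<le> curve_norm n f x + K" if "i \<in> {0..n}" for i
    using K[OF that] curve_norm_ge[OF that, of f x] by linarith
  moreover have "{i \<in> {0..n}. a i \<noteq> - \<infinity>} \<noteq> {}"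
    using a by (auto simp: trop_nonzero_vecs_def)
  ultimately show ?thesis
    unfolding trop_linear_comp_eq_Max[OF a] by (intro Max.boundedI) auto
qed

lemma trop_convex_trop_linear_comp:
  assumes a: "a \<in> trop_nonzero_vecs n" and f: "\<And>i. i \<in> {0..n} \<Longrightarrow> trop_convex (f i)"
  shows "trop_convex (trop_linear_comp n a f)"
proof -
  have "{i \<in> {0..n}. a i \<noteq> - \<infinity>} \<noteq> {}"
    using a by (auto simp: trop_nonzero_vecs_def)
  then have "trop_convex (\<lambda>x. Max ((\<lambda>i. real_of_ereal (a i) + f i x) ` {i \<in> {0..n}. a i \<noteq> - \<infinity>}))"
    using f by (intro trop_convex_Max trop_convex_add trop_convex_const) auto
  then show ?thesis
    by (simp add: trop_linear_comp_eq_Max[OF a, abs_def])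
qed

text \<open>By convexity \<open>T\<close> either grows linearly or vanishes identically. In the
second case every \<open>f i\<close> is convex with a bounded symmetric sum, hence affine, and boundedness of
\<open>f i r + f k (- r)\<close> forces all slopes to agree. Then \<open>f 0\<close> and \<open>f 1\<close> differ by a constant, and the linear
form that balances these two coordinates and ignores the others vanishes tropically on the curve.\<close>

lemma characteristic_fun_at_top:
  assumes "n \<ge> 1" and f: "\<And>i. i \<in> {0..n} \<Longrightarrow> trop_convex (f i)"
    and nondeg: "trop_linearly_nondegenerate n f"
  shows "filterlim (characteristic_fun n f) at_top at_top"
proof -
  let ?F = "curve_norm n f" and ?T = "characteristic_fun n f"
  have F: "convex_on UNIV ?F"
    using trop_convex_curve_norm[of n f] f by (simp add: trop_convex_def)
  have T: "2 * ?T r = ?F r + ?F (- r) - 2 * ?F 0" for r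
    by (simp add: characteristic_fun_def)
  have "\<exists>r>0. ?T r > 0"
  proof (rule ccontr)
    assume no: "\<not> ?thesis"
    have bound: "?F r + ?F (- r) \<le> 2 * ?F 0" if "r > 0" for r
    proof -
      have "?T r \<le> 0" using no that by (meson not_le)
      then show ?thesis using T[of r] by linarith
    qed
    have cross: "f i r + f k (- r) \<le> 2 * ?F 0" if "i \<in> {0..n}" "k \<in> {0..n}" "r > 0" for i k r
      using curve_norm_ge[OF that(1), of f r] curve_norm_ge[OF that(2), of f "- r"] bound[OF that(3)]
      by linarith
    have affine: "f i x = f i 0 + (f i 1 - f i 0) * x" if i: "i \<in> {0..n}" for i x
    proof (rule affine_of_symmetric_sum_const)
      show conv: "convex_on UNIV (f i)"
        using f[OF i] by (simp add: trop_convex_def)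
      fix s :: real assume "s > 0"
      have "(f i s + f i (- s) - 2 * f i 0) / s * r \<le> 2 * ?F 0 - 2 * f i 0 + \<bar>f i s + f i (- s) - 2 * f i 0\<bar>"
        if "r > 0" for r
      proof (cases "s \<le> r")
        case True
        then show ?thesis
          using symmetric_sum_growth[OF conv \<open>s > 0\<close> True] cross[OF i i that] by linarith
      next
        case False
        have "(f i s + f i (- s) - 2 * f i 0) / s * r \<le> \<bar>f i s + f i (- s) - 2 * f i 0\<bar> / s * s"
          using False \<open>s > 0\<close> that by (intro mult_mono divide_right_mono) auto
        then show ?thesis
          using \<open>s > 0\<close> curve_norm_ge[OF i, of f 0] by simp
      qed
      then have "(f i s + f i (- s) - 2 * f i 0) / s \<le> 0"
        by (rule nonpos_if_multiples_bounded)
      then have "f i s + f i (- s) \<le> 2 * f i 0"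
        using \<open>s > 0\<close> by (simp add: divide_le_0_iff)
      moreover have "2 * f i 0 \<le> f i s + f i (- s)"
        using symmetric_sum_mono[OF conv, of 0 s] \<open>s > 0\<close> by simp
      ultimately show "f i s + f i (- s) = 2 * f i 0" by simp
    qed
    have slope_le: "f i 1 - f i 0 \<le> f k 1 - f k 0" if ik: "i \<in> {0..n}" "k \<in> {0..n}" for i k
    proof -
      have "((f i 1 - f i 0) - (f k 1 - f k 0)) * r \<le> 2 * ?F 0 - f i 0 - f k 0" if "r > 0" for r
        using cross[OF ik that] affine[OF ik(1), of r] affine[OF ik(2), of "- r"]
        by (simp add: algebra_simps)
      then have "(f i 1 - f i 0) - (f k 1 - f k 0) \<le> 0"
        by (rule nonpos_if_multiples_bounded)
      then show ?thesis by simp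
    qed
    have slope: "f 0 1 - f 0 0 = f 1 1 - f 1 0"
      using slope_le[of 0 1] slope_le[of 1 0] \<open>n \<ge> 1\<close> by simp
    define a :: "nat \<Rightarrow> ereal" where
      "a = (\<lambda>i\<in>{0..n}. if i \<le> 1 then ereal (- f i 0) else - \<infinity>)"
    have a: "a \<in> trop_nonzero_vecs n"
      unfolding trop_nonzero_vecs_def by (auto simp: a_def tropicals_def intro!: bexI[of _ 0])
    have "trop_curve n f x \<in> trop_hyperplane n a" for x
    proof -
      let ?x = "\<lambda>i\<in>{0..n}. ereal (f i x)"
      have summand: "a i + ?x i = (if i \<le> 1 then ereal ((f 0 1 - f 0 0) * x) else - \<infinity>)"
        if "i \<in> {0..n}" for i
      proof (cases "i \<le> 1")
        case True
        then have "i = 0 \<or> i = 1" by auto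
        then have "f i 1 - f i 0 = f 0 1 - f 0 0"
          using slope by auto
        then show ?thesis
          using affine[OF that, of x] True that by (simp add: a_def)
      qed (use that in \<open>auto simp: a_def\<close>)
      have "trop_linear n a ?x = ereal ((f 0 1 - f 0 0) * x)"
        unfolding trop_linear_def
      proof (rule Max_eqI)
        show "ereal ((f 0 1 - f 0 0) * x) \<in> (\<lambda>i. a i + ?x i) ` {0..n}"
          using summand[of 0] by (intro image_eqI[of _ _ 0]) auto
        show "\<And>y. y \<in> (\<lambda>i. a i + ?x i) ` {0..n} \<Longrightarrow> y \<le> ereal ((f 0 1 - f 0 0) * x)"
          using summand by (auto simp del: restrict_apply)
      qed simp
      then have "max_attained_twice n a ?x"
        unfolding max_attained_twice_def using summand[of 0] summand[of 1] \<open>n \<ge> 1\<close>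
        by (intro bexI[of _ 0] bexI[of _ 1]) auto
      moreover have "?x \<in> trop_nonzero_vecs n"
        by (auto simp: trop_nonzero_vecs_def tropicals_def)
      ultimately show ?thesis
        unfolding trop_curve_def by (intro trop_point_in_hyperplaneI)
    qed
    then show False
      using nondeg a unfolding trop_linearly_nondegenerate_def by blast
  qed
  then obtain r\<^sub>0 where r\<^sub>0: "r\<^sub>0 > 0" "?T r\<^sub>0 > 0" by blast
  have "?T r\<^sub>0 / r\<^sub>0 * r \<le> ?T r" if "r\<^sub>0 \<le> r" for r
    using symmetric_sum_growth[OF F r\<^sub>0(1) that] r\<^sub>0(1) unfolding T[symmetric]
    by (simp add: field_simps)
  then have "\<forall>\<^sub>F r in at_top. ?T r\<^sub>0 / r\<^sub>0 * r \<le> ?T r"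
    by (rule eventually_mono[OF eventually_ge_at_top[of r\<^sub>0]])
  moreover have "filterlim (\<lambda>r. ?T r\<^sub>0 / r\<^sub>0 * r) at_top at_top"
    using r\<^sub>0 by (intro filterlim_tendsto_pos_mult_at_top[OF tendsto_const] filterlim_ident) auto
  ultimately show ?thesis
    by (rule filterlim_at_top_mono[rotated])
qed

lemma exists_smallest_subset:
  fixes v :: "'a \<Rightarrow> real"
  assumes "finite J" "m \<le> card J"
  shows "\<exists>B\<subseteq>J. card B = m \<and> (\<forall>b\<in>B. \<forall>j\<in>J - B. v b \<le> v j)"
  using assms(2)
proof (induction m)
  case 0
  show ?case by (intro exI[of _ "{}"]) auto
next
  case (Suc m)
  then obtain B where B: "B \<subseteq> J" "card B = m" "\<forall>b\<in>B. \<forall>j\<in>J - B. v b \<le> v j" by auto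
  have "finite B" using B(1) assms(1) finite_subset by blast
  have ne: "J - B \<noteq> {}" using B Suc.prems by auto
  obtain k where k: "k \<in> J - B" "\<forall>j\<in>J - B. v k \<le> v j"
    using ex_min_if_finite[of "v ` (J - B)"] assms(1) ne by (force simp: not_less)
  have "card (insert k B) = Suc m" using k(1) B(2) \<open>finite B\<close> by simp
  moreover have "\<forall>b\<in>insert k B. \<forall>j\<in>J - insert k B. v b \<le> v j" using k B(3) by auto
  ultimately show ?case using k(1) B(1) by (intro exI[of _ "insert k B"]) auto
qed

text \<open>The core inequality, at a fixed point \<open>x\<close>. Let \<open>B\<close> index the \<open>n + 1\<close> smallest values \<open>g j x\<close> of the
linear forms. A finite matching \<open>\<sigma>\<close> between \<open>B\<close> and the coordinates bounds each \<open>f (\<sigma> k)\<close> by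
\<open>g (\<mu> k) + K\<close>. It serves twice. Inserted into the Casorati determinant, it bounds each term by the sum
of the \<open>g b\<close> over \<open>b \<in> B\<close> at shifted points, which is comparable to the unshifted sum. Moreover,
some \<open>g b x\<close> with \<open>b \<in> B\<close> reaches the norm of the curve up to \<open>K\<close>, hence so do all the \<open>Q - (n + 1)\<close>
forms outside \<open>B\<close>, which are at least as large.\<close>

lemma casorati_pointwise_estimate:
  assumes Q: "n + 1 \<le> Q"
    and a: "\<And>j. j \<in> {1..Q} \<Longrightarrow> a j \<in> trop_nonzero_vecs n"
    and match: "\<And>\<mu>. \<mu> \<in> {0..n} \<rightarrow> {1..Q} \<Longrightarrow> inj_on \<mu> {0..n} \<Longrightarrow>
      \<exists>\<sigma>. \<sigma> permutes {0..n} \<and> (\<forall>k\<in>{0..n}. a (\<mu> k) (\<sigma> k) \<noteq> - \<infinity>)"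
    and K: "\<And>j i. j \<in> {1..Q} \<Longrightarrow> i \<in> {0..n} \<Longrightarrow> \<bar>real_of_ereal (a j i)\<bar> \<le> K"
    and shift: "\<And>j k. j \<in> {1..Q} \<Longrightarrow> k \<le> n \<Longrightarrow>
      trop_linear_comp n (a j) f (x + real k * c) \<le> trop_linear_comp n (a j) f x + \<epsilon>"
  shows "casorati n c f x + real (Q - (n + 1)) * (curve_norm n f x - K)
    \<le> (\<Sum>j\<in>{1..Q}. trop_linear_comp n (a j) f x) + real (n + 1) * (\<epsilon> + K)"
proof -
  define g where "g j = trop_linear_comp n (a j) f" for j
  obtain B where B: "B \<subseteq> {1..Q}" "card B = n + 1" "\<forall>b\<in>B. \<forall>j\<in>{1..Q} - B. g b x \<le> g j x"
    using exists_smallest_subset[of "{1..Q}" "n + 1" "\<lambda>j. g j x"] Q by auto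
  have "finite B" using B(1) finite_subset by blast
  obtain \<mu> where \<mu>: "bij_betw \<mu> {0..n} B"
    using finite_same_card_bij[of "{0..n}" B] \<open>finite B\<close> B(2) by auto
  have \<mu>Q: "\<mu> k \<in> {1..Q}" if "k \<in> {0..n}" for k
    using bij_betwE[OF \<mu>] that B(1) by blast
  obtain \<sigma> where \<sigma>: "\<sigma> permutes {0..n}" "\<And>k. k \<in> {0..n} \<Longrightarrow> a (\<mu> k) (\<sigma> k) \<noteq> - \<infinity>"
    using match[of \<mu>] \<mu> \<mu>Q by (auto simp: bij_betw_def)
  have \<sigma>n: "\<sigma> k \<in> {0..n}" if "k \<in> {0..n}" for k
    using permutes_in_image[OF \<sigma>(1)] that by blast
  have entry: "f (\<sigma> k) y \<le> g (\<mu> k) y + K" if "k \<in> {0..n}" for k y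
    using trop_linear_comp_ge[OF a[OF \<mu>Q[OF that]] \<sigma>n[OF that] \<sigma>(2)[OF that], of f y]
      K[OF \<mu>Q[OF that] \<sigma>n[OF that]] unfolding g_def by linarith
  have "casorati n c f x \<le> (\<Sum>k\<in>{0..n}. g (\<mu> k) x) + real (n + 1) * (\<epsilon> + K)"
    unfolding casorati_def
  proof (rule Max.boundedI)
    fix y assume "y \<in> (\<lambda>p. \<Sum>i=0..n. f i (x + real (p i) * c)) ` {p. p permutes {0..n}}"
    then obtain p where p: "p permutes {0..n}" "y = (\<Sum>i=0..n. f i (x + real (p i) * c))" by blast
    have "y = (\<Sum>k\<in>{0..n}. f (\<sigma> k) (x + real (p (\<sigma> k)) * c))"
      unfolding p(2) by (subst sum.permute[OF \<sigma>(1)]) (simp add: o_def)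
    also have "\<dots> \<le> (\<Sum>k\<in>{0..n}. g (\<mu> k) x + (\<epsilon> + K))"
    proof (rule sum_mono)
      fix k assume k: "k \<in> {0..n}"
      have "p (\<sigma> k) \<le> n" using permutes_in_image[OF p(1)] \<sigma>n[OF k] by simp
      then show "f (\<sigma> k) (x + real (p (\<sigma> k)) * c) \<le> g (\<mu> k) x + (\<epsilon> + K)"
        using entry[OF k, of "x + real (p (\<sigma> k)) * c"] shift[OF \<mu>Q[OF k]]
        by (fastforce simp: g_def)
    qed
    finally show "y \<le> (\<Sum>k\<in>{0..n}. g (\<mu> k) x) + real (n + 1) * (\<epsilon> + K)"
      by (simp add: sum.distrib algebra_simps)
  next
    show "(\<lambda>p. \<Sum>i=0..n. f i (x + real (p i) * c)) ` {p. p permutes {0..n}} \<noteq> {}"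
      using permutes_id by blast
  qed (simp add: finite_permutations)
  moreover have "(\<Sum>k\<in>{0..n}. g (\<mu> k) x) = (\<Sum>j\<in>B. g j x)"
    by (rule sum.reindex_bij_betw[OF \<mu>])
  moreover have "(\<Sum>j\<in>{1..Q} - B. curve_norm n f x - K) \<le> (\<Sum>j\<in>{1..Q} - B. g j x)"
  proof (rule sum_mono)
    fix j assume j: "j \<in> {1..Q} - B"
    obtain i where i: "i \<in> {0..n}" "curve_norm n f x = f i x"
      using curve_norm_attained by blast
    obtain k where k: "k \<in> {0..n}" "i = \<sigma> k"
      using permutes_image[OF \<sigma>(1)] i(1) by blast
    have "\<mu> k \<in> B" using \<mu> k(1) by (auto simp: bij_betw_def)
    then have "g (\<mu> k) x \<le> g j x" using B(3) j by blast
    then show "curve_norm n f x - K \<le> g j x"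
      using entry[OF k(1), of x] i(2) k(2) by simp
  qed
  moreover have "card ({1..Q} - B) = Q - (n + 1)"
    using B(1,2) \<open>finite B\<close> by (simp add: card_Diff_subset)
  moreover have "(\<Sum>j\<in>{1..Q}. g j x) = (\<Sum>j\<in>{1..Q} - B. g j x) + (\<Sum>j\<in>B. g j x)"
    by (rule sum.subset_diff[OF B(1)]) simp
  ultimately show ?thesis unfolding g_def by simp
qed

section \<open>Shifts of slowly growing functions\<close>

text \<open>For \<open>L = ln U\<close> the increments \<open>F t = L (t + s) - L t\<close> have integral at most \<open>s * L (R + s) = o(R)\<close> over
\<open>[1, R]\<close>, because the integral telescopes. By Markov's inequality \<open>F\<close> exceeds a threshold only on a small
set. With the threshold \<open>sqrt (m t)\<close>, where \<open>m t\<close> is the decreasing envelope of \<open>(L (t + s) + 1) / t\<close>, the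
exceptional set up to \<open>R\<close> has measure at most \<open>s * sqrt (m R) * R = o(R)\<close>, while \<open>F\<close> tends to \<open>0\<close> off it.
The square root splits the smallness of \<open>m\<close> evenly between these two requirements.\<close>

lemma slow_growth_shift:
  fixes U :: "real \<Rightarrow> real"
  assumes cont: "continuous_on UNIV U"
    and U1: "\<And>r. U r \<ge> 1"
    and mono: "\<And>r r'. 0 \<le> r \<Longrightarrow> r \<le> r' \<Longrightarrow> U r \<le> U r'"
    and slow: "((\<lambda>r. ln (U r) / r) \<longlongrightarrow> 0) at_top"
    and "s \<ge> 0"
  shows "\<exists>E. zero_upper_density E \<and> (\<lambda>r. U (r + s) - U r) \<in> o[at_top_outside E](U)"
proof -
  define L where "L r = ln (U r)" for r
  \<comment> \<open>The summand \<open>1\<close> keeps the envelope \<open>m\<close> positive, so that one may divide by \<open>sqrt (m R)\<close>.\<close>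
  define rate where "rate t = (L (t + s) + 1) / t" for t
  define m where "m R = (SUP t\<in>{R..}. rate t)" for R
  have L0: "L r \<ge> 0" for r using U1[of r] by (simp add: L_def)
  have Lmono: "L r \<le> L r'" if "0 \<le> r" "r \<le> r'" for r r'
    using mono[OF that] U1[of r] by (simp add: L_def)
  have Lcont: "continuous_on A L" for A
    unfolding L_def using U1 less_le_trans[OF zero_less_one U1]
    by (intro continuous_intros continuous_on_subset[OF cont]) (auto simp: less_imp_neq[symmetric])
  have "((\<lambda>t. L (t + s) / (t + s) * (1 + s / t) + 1 / t) \<longlongrightarrow> 0 * (1 + 0) + 0) at_top"
  proof (intro tendsto_intros)
    have "filterlim (\<lambda>t. t + s) at_top (at_top :: real filter)"
      using filterlim_tendsto_add_at_top[OF tendsto_const filterlim_ident, of s]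
      by (simp add: add.commute)
    from filterlim_compose[OF slow this] show "((\<lambda>t. L (t + s) / (t + s)) \<longlongrightarrow> 0) at_top"
      by (simp add: L_def)
    show "((\<lambda>t. s / t) \<longlongrightarrow> 0) at_top" "((\<lambda>t :: real. 1 / t) \<longlongrightarrow> 0) at_top"
      by (auto intro!: real_tendsto_divide_at_top[OF tendsto_const] filterlim_ident)
  qed
  moreover have "\<forall>\<^sub>F t in at_top. L (t + s) / (t + s) * (1 + s / t) + 1 / t = rate t"
    using eventually_gt_at_top[of 0]
  proof eventually_elim
    case (elim t)
    then have eq: "1 + s / t = (t + s) / t" and "t + s \<noteq> 0"
      using \<open>s \<ge> 0\<close> by (auto simp: field_simps)
    then have "L (t + s) / (t + s) * ((t + s) / t) = L (t + s) / t" by simp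
    then show ?case unfolding eq rate_def by (simp only: add_divide_distrib)
  qed
  ultimately have rate_lim: "(rate \<longlongrightarrow> 0) at_top"
    by (auto intro: Lim_transform_eventually)
  have rate_ev: "\<exists>R\<ge>1. \<forall>t\<ge>R. rate t \<le> \<epsilon>" if "\<epsilon> > 0" for \<epsilon>
  proof -
    have "\<forall>\<^sub>F t in at_top. rate t < \<epsilon>" using order_tendstoD(2)[OF rate_lim that] .
    then obtain R where "\<forall>t\<ge>R. rate t < \<epsilon>" by (auto simp: eventually_at_top_linorder)
    then show ?thesis by (intro exI[of _ "max 1 R"]) (auto intro: less_imp_le)
  qed
  obtain R\<^sub>0 where R\<^sub>0: "R\<^sub>0 \<ge> 1" "\<And>t. t \<ge> R\<^sub>0 \<Longrightarrow> rate t \<le> 1"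
    using rate_ev[of 1] by auto
  have bdd: "bdd_above (rate ` {R..})" if "R \<ge> R\<^sub>0" for R
    using R\<^sub>0(2) that by (intro bdd_aboveI[of _ 1]) auto
  have rate_le: "rate R \<le> m R" if "R \<ge> R\<^sub>0" for R
    unfolding m_def using bdd[OF that] by (intro cSUP_upper) auto
  have m_pos: "m R > 0" if "R \<ge> R\<^sub>0" for R
  proof -
    have "rate R > 0" using L0[of "R + s"] that R\<^sub>0(1) by (auto simp: rate_def)
    then show ?thesis using rate_le[OF that] by simp
  qed
  have m_anti: "m R' \<le> m R" if "R\<^sub>0 \<le> R" "R \<le> R'" for R R'
    unfolding m_def using bdd[OF that(1)] that(2) by (intro cSUP_subset_mono) auto
  have m_lim: "(m \<longlongrightarrow> 0) at_top"
  proof (rule order_tendstoI)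
    fix y :: real assume "y < 0"
    show "\<forall>\<^sub>F R in at_top. y < m R"
      using eventually_ge_at_top[of R\<^sub>0]
    proof eventually_elim
      case (elim R)
      show ?case using m_pos[OF elim] \<open>y < 0\<close> by simp
    qed
  next
    fix y :: real assume "0 < y"
    then obtain R where R: "\<And>t. t \<ge> R \<Longrightarrow> rate t \<le> y / 2"
      using rate_ev[of "y / 2"] by auto
    show "\<forall>\<^sub>F R in at_top. m R < y"
      using eventually_ge_at_top[of R]
    proof eventually_elim
      case (elim R')
      have "m R' \<le> y / 2"
        unfolding m_def using R elim by (intro cSUP_least) auto
      then show ?case using \<open>0 < y\<close> by simp
    qed
  qed
  define F where "F t = L (t + s) - L t" for t
  define E where "E = {t. R\<^sub>0 \<le> t \<and> sqrt (m t) < F t}"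
  have Fcont: "continuous_on A F" for A
    unfolding F_def
    by (intro continuous_intros Lcont continuous_on_compose2[OF Lcont[of UNIV], of _ "\<lambda>t. t + s"]) auto
  have F0: "F t \<ge> 0" if "t \<ge> 0" for t
    using Lmono[of t "t + s"] that \<open>s \<ge> 0\<close> by (simp add: F_def)
  have E_borel: "E \<in> sets borel"
  proof -
    \<comment> \<open>The envelope is monotone only from \<open>R\<^sub>0\<close> on; it is extended by a constant to the left.\<close>
    have "mono (\<lambda>t. - sqrt (m (max R\<^sub>0 t)))"
      by (intro monoI) (auto intro!: m_anti)
    then have "(\<lambda>t. - sqrt (m (max R\<^sub>0 t))) \<in> borel_measurable borel"
      by (rule borel_measurable_mono)
    moreover have "F \<in> borel_measurable borel"
      by (rule borel_measurable_continuous_onI[OF Fcont])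
    ultimately have "{t \<in> space borel. 0 < - sqrt (m (max R\<^sub>0 t)) + F t} \<in> sets borel"
      by measurable
    moreover have "E = {R\<^sub>0..} \<inter> {t \<in> space borel. 0 < - sqrt (m (max R\<^sub>0 t)) + F t}"
      by (auto simp: E_def max_def)
    ultimately show ?thesis by (auto intro: sets.Int)
  qed
  have meas: "measure lebesgue (E \<inter> {1..R}) / R \<le> s * sqrt (m R)" if R: "R \<ge> R\<^sub>0" for R
  proof -
    let ?S = "E \<inter> {1..R}"
    have "R \<ge> 1" using R R\<^sub>0(1) by simp
    have S: "?S \<in> sets borel" using E_borel by auto
    have "emeasure lborel ?S \<le> emeasure lborel {1..R}"
      by (intro emeasure_mono) auto
    then have "emeasure lborel ?S < \<infinity>"
      by (rule le_less_trans) (simp add: emeasure_lborel_Icc_eq)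
    from has_integral_measure_lborel[OF S this]
    have "((\<lambda>t. if t \<in> ?S then 1 else 0) has_integral measure lborel ?S) {1..R}"
      by (subst has_integral_restrict) auto
    then have "((\<lambda>t. sqrt (m R) * (if t \<in> ?S then 1 else 0)) has_integral sqrt (m R) * measure lborel ?S) {1..R}"
      by (rule has_integral_mult_right)
    moreover have "(F has_integral integral {1..R} F) {1..R}"
      by (intro integrable_integral integrable_continuous_interval Fcont)
    moreover have "sqrt (m R) * (if t \<in> ?S then 1 else 0) \<le> F t" if "t \<in> {1..R}" for t
    proof (cases "t \<in> E")
      case True
      then have "m R \<le> m t" and "sqrt (m t) \<le> F t"
        using m_anti[of t R] that by (auto simp: E_def)
      then have "sqrt (m R) \<le> F t"
        using real_sqrt_le_mono order_trans by blast
      then show ?thesis using True that by auto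
    qed (use F0 that in auto)
    ultimately have "sqrt (m R) * measure lborel ?S \<le> integral {1..R} F"
      by (rule has_integral_le)
    also have "integral {1..R} F \<le> s * L (R + s)"
    proof -
      have Li: "L integrable_on {u..v}" for u v
        by (intro integrable_continuous_interval Lcont)
      have shift: "integral {1..R} (\<lambda>t. L (t + s)) = integral {1 + s..R + s} L"
        using integral_shift[OF Lcont, of 1 R s] by (simp add: o_def)
      have "(\<lambda>t. L (t + s)) integrable_on {1..R}"
        by (intro integrable_continuous_interval continuous_on_compose2[OF Lcont[of UNIV]] continuous_intros) auto
      then have "integral {1..R} F = integral {1 + s..R + s} L - integral {1..R} L"
        unfolding F_def shift[symmetric] by (intro integral_diff Li)
      also have "integral {1 + s..R + s} L \<le> integral {1..R + s} L"
        using L0 \<open>s \<ge> 0\<close> by (intro integral_subset_le Li) auto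
      also have "integral {1..R + s} L = integral {1..R} L + integral {R..R + s} L"
        using Li \<open>R \<ge> 1\<close> \<open>s \<ge> 0\<close> by (intro Henstock_Kurzweil_Integration.integral_combine[symmetric]) auto
      also have "integral {R..R + s} L \<le> integral {R..R + s} (\<lambda>_. L (R + s))"
        using \<open>R \<ge> 1\<close> \<open>s \<ge> 0\<close> by (intro integral_le Li) (auto intro!: Lmono)
      also have "integral {R..R + s} (\<lambda>_. L (R + s)) = s * L (R + s)"
        using \<open>s \<ge> 0\<close> by simp
      finally show ?thesis by simp
    qed
    also have "s * L (R + s) \<le> s * (m R * R)"
    proof -
      have "(L (R + s) + 1) / R \<le> m R" using rate_le[OF R] by (simp add: rate_def)
      then have "L (R + s) \<le> m R * R" using \<open>R \<ge> 1\<close> by (simp add: field_simps)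
      then show ?thesis using \<open>s \<ge> 0\<close> by (intro mult_left_mono)
    qed
    also have "s * (m R * R) = sqrt (m R) * (s * sqrt (m R) * R)"
      using m_pos[OF R] by (simp add: algebra_simps flip: power2_eq_square)
    finally have "measure lborel ?S \<le> s * sqrt (m R) * R"
      using m_pos[OF R] by simp
    moreover have "measure lebesgue ?S = measure lborel ?S"
      using S by simp
    ultimately show ?thesis using \<open>R \<ge> 1\<close> by (simp add: field_simps)
  qed
  have "((\<lambda>R. measure lebesgue (E \<inter> {1..R}) / R) \<longlongrightarrow> 0) at_top"
  proof (rule tendsto_sandwich)
    show "\<forall>\<^sub>F R in at_top. 0 \<le> measure lebesgue (E \<inter> {1..R}) / R"
      using eventually_ge_at_top[of 0] by eventually_elim auto
    show "\<forall>\<^sub>F R in at_top. measure lebesgue (E \<inter> {1..R}) / R \<le> s * sqrt (m R)"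
      using eventually_ge_at_top[of R\<^sub>0] by eventually_elim (rule meas)
    show "((\<lambda>R. s * sqrt (m R)) \<longlongrightarrow> 0) at_top"
      using tendsto_mult[OF tendsto_const tendsto_real_sqrt[OF m_lim], of s] by simp
  qed simp
  then have "((\<lambda>R. ereal (measure lebesgue (E \<inter> {1..R}) / R)) \<longlongrightarrow> ereal 0) at_top"
    by (rule tendsto_ereal)
  moreover have "1 / R * (LINT t:E \<inter> {1..R}|lebesgue. 1) = measure lebesgue (E \<inter> {1..R}) / R" for R :: real
    by (simp add: set_lebesgue_integral_def)
  ultimately have "((\<lambda>R. ereal (1 / R * (LINT t:E \<inter> {1..R}|lebesgue. 1))) \<longlongrightarrow> 0) at_top"
    by (simp only: zero_ereal_def)
  then have "zero_upper_density E"
    unfolding zero_upper_density_def using E_borel by (auto intro!: lim_imp_Limsup)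
  moreover have "(\<lambda>r. U (r + s) - U r) \<in> o[at_top_outside E](U)"
  proof (rule landau_o.smallI)
    fix \<epsilon> :: real assume "\<epsilon> > 0"
    have "((\<lambda>R. exp (sqrt (m R)) - 1) \<longlongrightarrow> exp (sqrt 0) - 1) at_top"
      by (intro tendsto_intros m_lim)
    then have "\<forall>\<^sub>F R in at_top. exp (sqrt (m R)) - 1 < \<epsilon>"
      using \<open>\<epsilon> > 0\<close> by (intro order_tendstoD) auto
    then have "\<forall>\<^sub>F r in at_top. r \<in> - E \<longrightarrow> norm (U (r + s) - U r) \<le> \<epsilon> * norm (U r)"
      using eventually_ge_at_top[of R\<^sub>0]
    proof eventually_elim
      case (elim r)
      show ?case
      proof
        assume "r \<in> - E"
        then have "L (r + s) \<le> sqrt (m r) + L r"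
          using elim(2) by (auto simp: E_def F_def not_less)
        then have "exp (L (r + s)) \<le> exp (sqrt (m r)) * exp (L r)"
          by (simp flip: exp_add)
        then have "U (r + s) \<le> exp (sqrt (m r)) * U r"
          using less_le_trans[OF zero_less_one U1] by (simp add: L_def)
        also have "\<dots> \<le> (1 + \<epsilon>) * U r"
          using elim(1) U1[of r] by (intro mult_right_mono) auto
        finally have "U (r + s) - U r \<le> \<epsilon> * U r" by (simp add: algebra_simps)
        moreover have "U r \<le> U (r + s)"
          using elim(2) R\<^sub>0(1) \<open>s \<ge> 0\<close> by (intro mono) auto
        ultimately show "norm (U (r + s) - U r) \<le> \<epsilon> * norm (U r)"
          using U1[of r] by simp
      qed
    qed
    then show "\<forall>\<^sub>F r in at_top_outside E. norm (U (r + s) - U r) \<le> \<epsilon> * norm (U r)"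
      unfolding at_top_outside_def eventually_inf_principal .
  qed
  ultimately show ?thesis by blast
qed

section \<open>The second main theorem\<close>

text \<open>If \<open>q \<le> n\<close>, the family is completed to \<open>n + 1\<close> hyperplanes, so that the core inequality applies. The
given linear forms are kept for \<open>j \<le> q\<close>.\<close>

lemma extend_to_matched_family:
  assumes "n \<ge> 1"
    and a: "\<And>j. j \<in> {1..q} \<Longrightarrow> a j \<in> trop_nonzero_vecs n"
    and gp: "general_position n q (\<lambda>j. trop_hyperplane n (a j))"
    and comp: "q \<le> n \<Longrightarrow> completable n q (\<lambda>j. trop_hyperplane n (a j))"
  shows "\<exists>a' Q. n + 1 \<le> Q \<and> q \<le> Q \<and> (\<forall>j\<in>{1..q}. a' j = a j) \<and>
    (\<forall>j\<in>{1..Q}. a' j \<in> trop_nonzero_vecs n) \<and>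
    (\<forall>\<mu>. \<mu> \<in> {0..n} \<rightarrow> {1..Q} \<longrightarrow> inj_on \<mu> {0..n} \<longrightarrow>
      (\<exists>\<sigma>. \<sigma> permutes {0..n} \<and> (\<forall>k\<in>{0..n}. a' (\<mu> k) (\<sigma> k) \<noteq> - \<infinity>)))"
proof (cases "q \<le> n")
  case False
  have "\<exists>\<sigma>. \<sigma> permutes {0..n} \<and> (\<forall>k\<in>{0..n}. a (\<mu> k) (\<sigma> k) \<noteq> - \<infinity>)"
    if "\<mu> \<in> {0..n} \<rightarrow> {1..q}" "inj_on \<mu> {0..n}" for \<mu>
    by (rule general_position_matching[OF \<open>n \<ge> 1\<close> a gp that])
  then show ?thesis
    using False a by (intro exI[of _ a] exI[of _ q]) auto
next
  case True
  then obtain b where b: "\<And>j. j \<in> {1..n + 1} \<Longrightarrow> b j \<in> trop_nonzero_vecs n"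
    and same: "\<And>j. j \<in> {1..q} \<Longrightarrow> trop_hyperplane n (b j) = trop_hyperplane n (a j)"
    and gpb: "general_position n (n + 1) (\<lambda>j. trop_hyperplane n (b j))"
    using comp unfolding completable_def by blast
  define a' where "a' j = (if j \<le> q then a j else b j)" for j
  have supp: "a' j i = - \<infinity> \<longleftrightarrow> b j i = - \<infinity>" if "j \<in> {1..n + 1}" "i \<in> {0..n}" for i j
    using hyperplane_determines_support[OF \<open>n \<ge> 1\<close> a b[OF that(1)] _ that(2)] same that
    by (auto simp: a'_def)
  have "\<exists>\<sigma>. \<sigma> permutes {0..n} \<and> (\<forall>k\<in>{0..n}. a' (\<mu> k) (\<sigma> k) \<noteq> - \<infinity>)"
    if \<mu>: "\<mu> \<in> {0..n} \<rightarrow> {1..n + 1}" "inj_on \<mu> {0..n}" for \<mu>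
  proof -
    obtain \<sigma> where \<sigma>: "\<sigma> permutes {0..n}" "\<forall>k\<in>{0..n}. b (\<mu> k) (\<sigma> k) \<noteq> - \<infinity>"
      using general_position_matching[OF \<open>n \<ge> 1\<close> b gpb \<mu>] by blast
    have "a' (\<mu> k) (\<sigma> k) \<noteq> - \<infinity>" if "k \<in> {0..n}" for k
    proof -
      have "\<mu> k \<in> {1..n + 1}" "\<sigma> k \<in> {0..n}"
        using \<mu>(1) that permutes_in_image[OF \<sigma>(1)] by blast+
      then show ?thesis using supp \<sigma>(2) that by blast
    qed
    then show ?thesis using \<sigma>(1) by blast
  qed
  then show ?thesis
    using True a b by (intro exI[of _ a'] exI[of _ "n + 1"]) (auto simp: a'_def)
qed

theorem theorem1p7:
  fixes n q :: nat and c :: real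
    and f :: "nat \<Rightarrow> real \<Rightarrow> real" and a :: "nat \<Rightarrow> nat \<Rightarrow> ereal"
  assumes "n \<ge> 1" and "q \<ge> 1" and "c \<noteq> 0"
    and "reduced_representation n f"
    and "trop_linearly_nondegenerate n f"
    and "\<And>j. j \<in> {1..q} \<Longrightarrow> a j \<in> trop_nonzero_vecs n"
    and "general_position n q (\<lambda>j. trop_hyperplane n (a j))"
    and "q \<le> n \<Longrightarrow> completable n q (\<lambda>j. trop_hyperplane n (a j))"
    and "Limsup at_top (\<lambda>r. ereal (ln (characteristic_fun n f r) / r)) = 0"
  shows "\<exists>E h. zero_upper_density E \<and>
    h \<in> o[at_top_outside E](characteristic_fun n f) \<and>
    (\<forall>\<^sub>F r in at_top_outside E.
      (real q - real n - 1) * characteristic_fun n f r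
        \<le> (\<Sum>j=1..q. counting_fun r (trop_inverse (trop_linear_comp n (a j) f)))
           - counting_fun r (trop_inverse (casorati n c f)) + h r)"
proof -
  have f: "trop_convex (f i)" if "i \<in> {0..n}" for i
    using assms(4) that by (auto simp: reduced_representation_def intro: trop_entire_trop_convex)
  obtain a' Q where Q: "n + 1 \<le> Q" "q \<le> Q"
    and a'_eq: "\<And>j. j \<in> {1..q} \<Longrightarrow> a' j = a j"
    and a': "\<And>j. j \<in> {1..Q} \<Longrightarrow> a' j \<in> trop_nonzero_vecs n"
    and match: "\<And>\<mu>. \<mu> \<in> {0..n} \<rightarrow> {1..Q} \<Longrightarrow> inj_on \<mu> {0..n} \<Longrightarrow>
      \<exists>\<sigma>. \<sigma> permutes {0..n} \<and> (\<forall>k\<in>{0..n}. a' (\<mu> k) (\<sigma> k) \<noteq> - \<infinity>)"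
    using extend_to_matched_family[OF assms(1,6,7,8)] by blast
  define g where "g j = trop_linear_comp n (a' j) f" for j
  define F where "F = curve_norm n f"
  define T where "T = characteristic_fun n f"
  define C where "C = casorati n c f"
  \<comment> \<open>Symmetric sums of the linear forms; \<open>U\<close> collects them into one function that controls all shifts.\<close>
  define S where "S j r = g j r + g j (- r)" for j r
  \<comment> \<open>The summand \<open>1\<close> makes \<open>ln (U r)\<close> nonnegative.\<close>
  define U where "U r = 1 + (\<Sum>j\<in>{1..Q}. S j r - S j 0)" for r
  define s where "s = real n * \<bar>c\<bar>"
  define W where "W r = U (r + s) - U r" for r
  define K where "K = (\<Sum>j\<in>{1..Q}. \<Sum>i\<in>{0..n}. \<bar>real_of_ereal (a' j i)\<bar>)"
  define K' where "K' = (\<Sum>j\<in>{1..Q}. \<bar>g j s - g j 0\<bar> + \<bar>g j (- s) - g j 0\<bar>)"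
  have "s \<ge> 0" by (simp add: s_def)
  have T: "T r = (F r + F (- r)) / 2 - F 0" for r
    by (simp add: T_def F_def characteristic_fun_def)
  have K: "\<bar>real_of_ereal (a' j i)\<bar> \<le> K" if "j \<in> {1..Q}" "i \<in> {0..n}" for j i
  proof -
    have "\<bar>real_of_ereal (a' j i)\<bar> \<le> (\<Sum>i\<in>{0..n}. \<bar>real_of_ereal (a' j i)\<bar>)"
      by (rule member_le_sum[OF that(2) abs_ge_zero]) simp
    also have "\<dots> \<le> K"
      unfolding K_def
      by (rule member_le_sum[OF that(1) sum_nonneg[OF abs_ge_zero]]) simp
    finally show ?thesis .
  qed
  have g: "trop_convex (g j)" if "j \<in> {1..Q}" for j
    unfolding g_def using trop_convex_trop_linear_comp[OF a'[OF that]] f by blast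
  then have g_conv: "convex_on UNIV (g j)" if "j \<in> {1..Q}" for j
    using that by (simp add: trop_convex_def)
  have C: "trop_convex C"
    unfolding C_def using f by (intro trop_convex_casorati)
  have g_le: "g j x \<le> F x + K" if "j \<in> {1..Q}" for j x
    unfolding g_def F_def using a'[OF that] K[OF that] by (rule trop_linear_comp_le)
  have S_mono: "S j r \<le> S j r'" if "j \<in> {1..Q}" "0 \<le> r" "r \<le> r'" for j r r'
    unfolding S_def using symmetric_sum_mono[OF g_conv[OF that(1)] that(2,3)] .
  have S_ge: "S j 0 \<le> S j r" if "j \<in> {1..Q}" for j r
    using S_mono[OF that, of 0 r] S_mono[OF that, of 0 "- r"] by (cases "r \<ge> 0") (auto simp: S_def)
  have U1: "U r \<ge> 1" for r
  proof -
    have "0 \<le> (\<Sum>j\<in>{1..Q}. S j r - S j 0)"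
      by (intro sum_nonneg) (simp only: diff_ge_0_iff_ge S_ge)
    then show ?thesis by (simp only: U_def le_add_same_cancel1)
  qed
  have U_mono: "U r \<le> U r'" if "0 \<le> r" "r \<le> r'" for r r'
    unfolding U_def using S_mono[OF _ that] by (intro add_left_mono sum_mono diff_right_mono) blast
  have U_cont: "continuous_on UNIV U"
  proof -
    have cont: "continuous_on UNIV (g j)" if "j \<in> {1..Q}" for j
      using g[OF that] locally_pl_continuous by (simp add: trop_convex_def)
    show ?thesis
      unfolding U_def S_def
      by (intro continuous_intros cont continuous_on_compose2[OF cont, of _ UNIV uminus]) auto
  qed
  define A where "A = (\<Sum>j\<in>{1..Q}. 2 * F 0 + 2 * K - S j 0)"
  define M where "M = \<bar>1 + A\<bar> + 2 * real Q"
  have "M > 0" using Q by (simp add: M_def)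
  have T_top: "filterlim T at_top at_top"
    unfolding T_def using characteristic_fun_at_top[OF assms(1) f assms(5)] .
  then have T_ge: "\<forall>\<^sub>F r in at_top. T r \<ge> k" for k
    by (simp add: filterlim_at_top)
  have U_le: "U r \<le> M * T r" if "T r \<ge> 1" for r
  proof -
    have "S j r - S j 0 \<le> 2 * T r + (2 * F 0 + 2 * K - S j 0)" if "j \<in> {1..Q}" for j
      using g_le[OF that, of r] g_le[OF that, of "- r"] T[of r] unfolding S_def by argo
    then have "(\<Sum>j\<in>{1..Q}. S j r - S j 0) \<le> (\<Sum>j\<in>{1..Q}. 2 * T r + (2 * F 0 + 2 * K - S j 0))"
      by (rule sum_mono)
    also have "\<dots> = 2 * real Q * T r + A"
      unfolding A_def by (subst sum.distrib) simp
    finally have "U r \<le> 1 + (2 * real Q * T r + A)"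
      unfolding U_def by (rule add_left_mono)
    also have "\<dots> \<le> 2 * real Q * T r + \<bar>1 + A\<bar> * 1"
      using abs_ge_self[of "1 + A"] by simp
    also have "\<dots> \<le> 2 * real Q * T r + \<bar>1 + A\<bar> * T r"
      using that by (intro add_left_mono mult_left_mono) auto
    finally show ?thesis by (simp add: M_def algebra_simps)
  qed
  have slow: "((\<lambda>r. ln (U r) / r) \<longlongrightarrow> 0) at_top"
  proof (rule order_tendstoI)
    fix y :: real assume "y < 0"
    show "\<forall>\<^sub>F r in at_top. y < ln (U r) / r"
      using eventually_gt_at_top[of 0]
    proof eventually_elim
      case (elim r)
      have "0 \<le> ln (U r) / r" using U1[of r] elim by simp
      then show ?case using \<open>y < 0\<close> by simp
    qed
  next
    fix y :: real assume "0 < y"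
    then have "Limsup at_top (\<lambda>r. ereal (ln (T r) / r)) < ereal (y / 2)"
      using assms(9) by (simp add: T_def)
    then have "\<forall>\<^sub>F r in at_top. ereal (ln (T r) / r) < ereal (y / 2)"
      by (rule Limsup_lessD)
    moreover have "\<forall>\<^sub>F r in at_top. ln M / r < y / 2"
    proof (rule order_tendstoD)
      show "((\<lambda>r. ln M / r) \<longlongrightarrow> 0) at_top"
        by (rule real_tendsto_divide_at_top[OF tendsto_const filterlim_ident])
    qed (use \<open>0 < y\<close> in simp)
    ultimately show "\<forall>\<^sub>F r in at_top. ln (U r) / r < y"
      using T_ge[of 1] eventually_gt_at_top[of 0]
    proof eventually_elim
      case (elim r)
      have "ln (U r) \<le> ln (M * T r)"
        using U_le[OF elim(3)] U1[of r] by (intro ln_mono) auto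
      also have "\<dots> = ln M + ln (T r)"
        using \<open>M > 0\<close> elim(3) by (simp add: ln_mult)
      finally have "ln (U r) / r \<le> ln M / r + ln (T r) / r"
        using elim(4) by (simp add: divide_right_mono flip: add_divide_distrib)
      moreover have "ln (T r) / r < y / 2" using elim(1) by (simp only: less_ereal.simps)
      ultimately show ?case using elim(2) by linarith
    qed
  qed
  obtain E where E: "zero_upper_density E" and "(\<lambda>r. U (r + s) - U r) \<in> o[at_top_outside E](U)"
    using slow_growth_shift[OF U_cont U1 U_mono slow \<open>s \<ge> 0\<close>] by blast
  then have "W \<in> o[at_top_outside E](U)"
    by (simp add: W_def[abs_def])
  have outside: "eventually P (at_top_outside E)" if "eventually P at_top" for P
    using that filter_leD[of "at_top_outside E" at_top P] by (simp add: at_top_outside_def)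
  have "U \<in> O[at_top_outside E](T)"
  proof (rule bigoI[of _ M])
    show "\<forall>\<^sub>F r in at_top_outside E. norm (U r) \<le> M * norm (T r)"
      using outside[OF T_ge[of 1]]
    proof eventually_elim
      case (elim r)
      then show ?case using U_le[OF elim] U1[of r] by simp
    qed
  qed
  with \<open>W \<in> o[at_top_outside E](U)\<close> have W_small: "W \<in> o[at_top_outside E](T)"
    by (rule landau_o.small_big_trans)
  have const_small: "(\<lambda>_. k) \<in> o[at_top_outside E](T)" for k :: real
  proof (rule landau_o.smallI)
    fix \<epsilon> :: real assume "\<epsilon> > 0"
    show "\<forall>\<^sub>F r in at_top_outside E. norm k \<le> \<epsilon> * norm (T r)"
      using outside[OF T_ge[of "\<bar>k\<bar> / \<epsilon>"]]
    proof eventually_elim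
      case (elim r)
      then have "\<bar>k\<bar> / \<epsilon> \<le> \<bar>T r\<bar>" by simp
      then show ?case using \<open>\<epsilon> > 0\<close> by (simp add: field_simps)
    qed
  qed
  define B where "B = real (n + 1) * (K' + K) + (real Q - real n - 1) * K + (real Q - real q) * K
    + (\<Sum>j=1..q. g j 0) - C 0 - (real q - real n - 1) * F 0"
  define h where "h r = real (n + 1) * W r + B" for r
  have "h \<in> o[at_top_outside E](T)"
    unfolding h_def using W_small const_small
    by (intro sum_in_smallo) auto
  moreover have "(real q - real n - 1) * T r
      \<le> (\<Sum>j=1..q. counting_fun r (trop_inverse (g j))) - counting_fun r (trop_inverse C) + h r"
    if "r \<ge> s" for r
  proof -
    have "r \<ge> 0" using that \<open>s \<ge> 0\<close> by simp
    have "S j (r + s) - S j r \<le> W r" if "j \<in> {1..Q}" for j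
    proof -
      have "W r = (\<Sum>j\<in>{1..Q}. S j (r + s) - S j r)"
        by (simp add: W_def U_def sum_subtractf)
      then show ?thesis
        using that S_mono \<open>r \<ge> 0\<close> \<open>s \<ge> 0\<close>
          member_le_sum[of j "{1..Q}" "\<lambda>j. S j (r + s) - S j r"] by simp
    qed
    moreover have "\<bar>g j s - g j 0\<bar> + \<bar>g j (- s) - g j 0\<bar> \<le> K'" if "j \<in> {1..Q}" for j
      unfolding K'_def using that
      by (intro member_le_sum[of j "{1..Q}" "\<lambda>j. \<bar>g j s - g j 0\<bar> + \<bar>g j (- s) - g j 0\<bar>"]) auto
    ultimately have err: "(g j (r + s) + g j (- (r + s)) - (g j r + g j (- r)))
        + (\<bar>g j s - g j 0\<bar> + \<bar>g j (- s) - g j 0\<bar>) \<le> W r + K'" if "j \<in> {1..Q}" for j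
      unfolding S_def using that by (intro add_mono)
    have d: "\<bar>real k * c\<bar> \<le> s" if "k \<le> n" for k
      unfolding s_def abs_mult using that by (simp add: mult_right_mono)
    have shift_r: "g j (r + real k * c) \<le> g j r + (W r + K')" if "j \<in> {1..Q}" "k \<le> n" for j k
      using convex_shift_le[OF g_conv[OF that(1)] d[OF that(2)] \<open>r \<ge> s\<close>] err[OF that(1)]
      by linarith
    \<comment> \<open>The estimate at \<open>- r\<close> is the one at \<open>r\<close> for the reflected function.\<close>
    have shift_l: "g j (- r + real k * c) \<le> g j (- r) + (W r + K')" if "j \<in> {1..Q}" "k \<le> n" for j k
    proof -
      have "\<bar>- (real k * c)\<bar> \<le> s" using d[OF that(2)] by simp
      from convex_shift_le[OF convex_reflect[OF g_conv[OF that(1)]] this \<open>r \<ge> s\<close>]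
      show ?thesis using err[OF that(1)] by (simp add: algebra_simps)
    qed
    have est: "C x + real (Q - (n + 1)) * (F x - K) \<le> (\<Sum>j\<in>{1..Q}. g j x) + real (n + 1) * (W r + K' + K)"
      if "x = r \<or> x = - r" for x
      unfolding C_def F_def g_def
    proof (rule casorati_pointwise_estimate[OF Q(1) a' match K])
      show "trop_linear_comp n (a' j) f (x + real k * c) \<le> trop_linear_comp n (a' j) f x + (W r + K')"
        if "j \<in> {1..Q}" "k \<le> n" for j k
        using shift_r[OF that] shift_l[OF that] \<open>x = r \<or> x = - r\<close> by (auto simp: g_def)
    qed auto
    \<comment> \<open>The linear forms that were only added by the completion are bounded by the norm of the curve.\<close>
    have split: "(\<Sum>j\<in>{1..Q}. g j x) \<le> (\<Sum>j=1..q. g j x) + (real Q - real q) * (F x + K)" for x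
    proof -
      have "{1..Q} = {1..q} \<union> {q + 1..Q}" using Q(2) by auto
      then have "(\<Sum>j\<in>{1..Q}. g j x) = (\<Sum>j=1..q. g j x) + (\<Sum>j\<in>{q + 1..Q}. g j x)"
        by (simp add: sum.union_disjoint)
      also have "(\<Sum>j\<in>{q + 1..Q}. g j x) \<le> (\<Sum>j\<in>{q + 1..Q}. F x + K)"
        by (intro sum_mono g_le) auto
      also have "\<dots> = (real Q - real q) * (F x + K)"
        using Q(2) by (simp add: of_nat_diff)
      finally show ?thesis by simp
    qed
    have NC: "counting_fun r (trop_inverse C) = (C r + C (- r)) / 2 - C 0"
      by (rule trop_Jensen[OF C \<open>r \<ge> 0\<close>])
    have "(\<Sum>j=1..q. counting_fun r (trop_inverse (g j))) = (\<Sum>j=1..q. (g j r + g j (- r)) / 2 - g j 0)"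
      using Q(2) by (intro sum.cong refl trop_Jensen g \<open>r \<ge> 0\<close>) auto
    also have "\<dots> = ((\<Sum>j=1..q. g j r) + (\<Sum>j=1..q. g j (- r))) / 2 - (\<Sum>j=1..q. g j 0)"
      by (simp add: sum_subtractf sum.distrib flip: sum_divide_distrib)
    finally have Ng: "(\<Sum>j=1..q. counting_fun r (trop_inverse (g j)))
        = ((\<Sum>j=1..q. g j r) + (\<Sum>j=1..q. g j (- r))) / 2 - (\<Sum>j=1..q. g j 0)" .
    have real_diff: "real (Q - (n + 1)) = real Q - real n - 1"
      using Q(1) by (simp add: of_nat_diff)
    define d where "d = real q - real n - 1"
    define e where "e = real (n + 1) * W r + (real (n + 1) * (K' + K)
      + (real Q - real n - 1) * K + (real Q - real q) * K)"
    have bound: "C x + d * F x \<le> (\<Sum>j=1..q. g j x) + e" if "x = r \<or> x = - r" for x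
      using est[OF that] split[of x] unfolding real_diff d_def e_def by (simp add: algebra_simps)
    have "d * ((F r + F (- r)) / 2 - F 0) = (d * F r + d * F (- r)) / 2 - d * F 0"
      by (simp add: field_simps)
    also have "\<dots> \<le> ((\<Sum>j=1..q. g j r) + (\<Sum>j=1..q. g j (- r))) / 2
        - (C r + C (- r)) / 2 + e - d * F 0"
      using bound[of r] bound[of "- r"] by argo
    also have "\<dots> = ((\<Sum>j=1..q. g j r) + (\<Sum>j=1..q. g j (- r))) / 2 - (\<Sum>j=1..q. g j 0)
        - ((C r + C (- r)) / 2 - C 0) + h r"
      unfolding h_def B_def e_def d_def by simp
    finally show ?thesis
      unfolding NC Ng T d_def .
  qed
  then have "\<forall>\<^sub>F r in at_top_outside E. (real q - real n - 1) * T r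
      \<le> (\<Sum>j=1..q. counting_fun r (trop_inverse (g j))) - counting_fun r (trop_inverse C) + h r"
    by (intro outside eventually_mono[OF eventually_ge_at_top[of s]])
  moreover have "(\<Sum>j=1..q. counting_fun r (trop_inverse (g j)))
      = (\<Sum>j=1..q. counting_fun r (trop_inverse (trop_linear_comp n (a j) f)))" for r
    by (intro sum.cong) (auto simp: g_def a'_eq)
  ultimately show ?thesis
    using E by (auto simp: T_def C_def)
qed

end
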